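(* Let $D=\{z\in\mathbb{C}:|z|<1\}$ and $n\in\mathbb{Z}_{\geq1}\cup\{\infty\}$, and consider the orbifold $(D/(1-\frac1n)\{0\})$. Then its orbifold Kobayashi pseudo-distance and classical orbifold Kobayashi pseudo-distance coincide, and both equal the pseudo-distance induced by the metric $$\omega=\frac{4\,dz\,d\bar z}{n^2|z|^{2-\frac2n}(1-|z|^{\frac2n})^2}$$ (for $n=\infty$ this is interpreted as $\omega=\frac{4\,dz\,d\bar z}{|z|^2(\log|z|^2)^2}$ on $D\setminus\{0\}$).
   Context: For an orbifold $(X/\Delta)$, $\Delta=\sum_i(1-\frac1{m_i})Z_i$ ($m_i\in\mathbb{Z}_{\ge1}\cup\{\infty\}$), let $\Delta_1$ be the union of the $Z_i$ with $m_i=\infty$. A holomorphic map $h:D\to X$ is an orbifold morphism (resp. classical orbifold morphism) to $(X/\Delta)$ if $h(D)\not\subset\operatorname{supp}\Delta$ and for all $i$ and all $x\in D$ with $h(x)\in Z_i$ the multiplicity of $h^*Z_i$ at $x$ is $\geq m_i$ (resp. is a multiple of $m_i$); if $m_i=\infty$ one requires $h(D)\cap Z_i=\emptyset$. The orbifold Kobayashi pseudo-distance $d_{(X/\Delta)}$ (resp. classical $d^*_{(X/\Delta)}$) is the largest pseudo-distance on $X\setminus\Delta_1$ such that $g^*d\leq d_P$ for every orbifold morphism (resp. classical orbifold morphism) $g:D\to(X/\Delta)$, where $d_P$ is the Poincaré distance on $D$, induced by $\frac{4\,dz\,d\bar z}{(1-|z|^2)^2}$. *)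

theory Defs
  imports "HOL-Analysis.Analysis" "HOL-Library.Extended_Nat"
begin

abbreviation unit_disc :: "complex set" where "unit_disc \<equiv> ball 0 1"

definition zero_mult :: "(complex \<Rightarrow> complex) \<Rightarrow> complex \<Rightarrow> enat" where
  "zero_mult h x = (if \<exists>k. (deriv ^^ k) h x \<noteq> 0
                    then enat (LEAST k. (deriv ^^ k) h x \<noteq> 0) else \<infinity>)"

definition orb_domain :: "enat \<Rightarrow> complex set" where
  "orb_domain n = (if n = \<infinity> then unit_disc - {0} else unit_disc)"

text \<open>Orbifold morphisms D -> (D/(1-1/n){0}).  The support of Delta is {0} if n /= 1,
  and empty if n = 1.\<close>
definition orb_morphism :: "enat \<Rightarrow> (complex \<Rightarrow> complex) \<Rightarrow> bool" where
  "orb_morphism n h \<longleftrightarrow> h holomorphic_on unit_disc \<and> h ` unit_disc \<subseteq> unit_disc \<and>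
     (n \<noteq> 1 \<longrightarrow> \<not> h ` unit_disc \<subseteq> {0}) \<and>
     (n = \<infinity> \<longrightarrow> 0 \<notin> h ` unit_disc) \<and>
     (\<forall>x\<in>unit_disc. h x = 0 \<longrightarrow> n \<le> zero_mult h x)"

definition classical_orb_morphism :: "enat \<Rightarrow> (complex \<Rightarrow> complex) \<Rightarrow> bool" where
  "classical_orb_morphism n h \<longleftrightarrow> h holomorphic_on unit_disc \<and> h ` unit_disc \<subseteq> unit_disc \<and>
     (n \<noteq> 1 \<longrightarrow> \<not> h ` unit_disc \<subseteq> {0}) \<and>
     (n = \<infinity> \<longrightarrow> 0 \<notin> h ` unit_disc) \<and>
     (\<forall>x\<in>unit_disc. h x = 0 \<longrightarrow> n = 1 \<or>
        (\<exists>m k. n = enat m \<and> zero_mult h x = enat k \<and> m dvd k))"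

definition path_len :: "(complex \<Rightarrow> real) \<Rightarrow> (real \<Rightarrow> complex) \<Rightarrow> real" where
  "path_len \<rho> \<gamma> = integral {0..1} (\<lambda>t. \<rho> (\<gamma> t) * norm (vector_derivative \<gamma> (at t)))"

definition induced_dist :: "complex set \<Rightarrow> (complex \<Rightarrow> real) \<Rightarrow> complex \<Rightarrow> complex \<Rightarrow> real" where
  "induced_dist S \<rho> x y = Inf {path_len \<rho> \<gamma> | \<gamma>. valid_path \<gamma> \<and> path_image \<gamma> \<subseteq> S \<and>
      pathstart \<gamma> = x \<and> pathfinish \<gamma> = y \<and>
      (\<lambda>t. \<rho> (\<gamma> t) * norm (vector_derivative \<gamma> (at t))) integrable_on {0..1}}"

definition poincare_dist :: "complex \<Rightarrow> complex \<Rightarrow> real" where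
  "poincare_dist = induced_dist unit_disc (\<lambda>z. 2 / (1 - norm z ^ 2))"

text \<open>Square root of the coefficient of omega.\<close>
definition omega_density :: "enat \<Rightarrow> complex \<Rightarrow> real" where
  "omega_density n z = (case n of
      enat m \<Rightarrow> 2 / (real m * norm z powr (1 - 1 / real m) * (1 - norm z powr (2 / real m)))
    | \<infinity> \<Rightarrow> 2 / (norm z * \<bar>ln (norm z ^ 2)\<bar>))"

definition pseudo_dist_on :: "complex set \<Rightarrow> (complex \<Rightarrow> complex \<Rightarrow> real) \<Rightarrow> bool" where
  "pseudo_dist_on S d \<longleftrightarrow> (\<forall>x\<in>S. d x x = 0) \<and> (\<forall>x\<in>S. \<forall>y\<in>S. d x y = d y x) \<and>
     (\<forall>x\<in>S. \<forall>y\<in>S. \<forall>z\<in>S. d x z \<le> d x y + d y z)"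

definition kob_admissible :: "complex set \<Rightarrow> ((complex \<Rightarrow> complex) \<Rightarrow> bool) \<Rightarrow> (complex \<Rightarrow> complex \<Rightarrow> real) \<Rightarrow> bool" where
  "kob_admissible S M d \<longleftrightarrow> pseudo_dist_on S d \<and>
     (\<forall>g. M g \<longrightarrow> (\<forall>a\<in>unit_disc. \<forall>b\<in>unit_disc. d (g a) (g b) \<le> poincare_dist a b))"

definition is_kobayashi :: "complex set \<Rightarrow> ((complex \<Rightarrow> complex) \<Rightarrow> bool) \<Rightarrow> (complex \<Rightarrow> complex \<Rightarrow> real) \<Rightarrow> bool" where
  "is_kobayashi S M d \<longleftrightarrow> kob_admissible S M d \<and>
     (\<forall>d'. kob_admissible S M d' \<longrightarrow> (\<forall>x\<in>S. \<forall>y\<in>S. d' x y \<le> d x y))"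

end

theory Submission
  imports Defs "HOL-Complex_Analysis.Complex_Analysis"
begin

text \<open>
  The disc covers the orbifold by \<open>z \<mapsto> z ^ n\<close> (for infinite \<open>n\<close>, by \<open>z \<mapsto> exp ((z + 1) / (z - 1))\<close>), which is
  a classical orbifold morphism and a local isometry from the Poincare metric to omega away from 0.
  Lifting a path through it bounds every admissible pseudo-distance by the length of the path; a path
  through 0 is cut at its first and last zero, near which the distance to 0 is small.

  Conversely, orbifold morphisms do not increase length. If \<open>g\<close> vanishes to order at least \<open>n\<close> at each of
  its zeros, write \<open>g\<close> on a slightly smaller disc as a product of Blaschke powers \<open>\<phi>\<^sub>a ^ k\<close> with \<open>k \<ge> n\<close> and a
  zero-free factor. The logarithmic derivative of \<open>\<phi>\<^sub>a\<close> is controlled by \<open>2 sinh (- ln \<bar>\<phi>\<^sub>a\<bar>)\<close>, that of the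
  zero-free factor \<open>u\<close> by \<open>2 (- ln \<bar>u\<bar>)\<close>, and superadditivity and convexity of sinh combine these to
  \<open>2 n sinh (- ln \<bar>g\<bar> / n)\<close>, which is the Schwarz-Pick inequality for omega. Only \<open>k \<ge> n\<close> enters, not
  divisibility of \<open>k\<close> by \<open>n\<close>, so both pseudo-distances are the same.
\<close>

section \<open>The Schwarz-Pick lemma\<close>

lemma one_minus_cnj_mult_nonzero:
  assumes "norm a < 1" "norm z < 1"
  shows "1 - cnj a * z \<noteq> 0"
proof -
  have "norm (cnj a * z) < 1 * 1"
    unfolding norm_mult complex_mod_cnj using assms by (intro mult_strict_mono') auto
  then show ?thesis by auto
qed

lemma has_field_derivative_Moebius_function:
  assumes "norm a < 1" "norm z < 1"
  shows "(Moebius_function 0 a has_field_derivative (1 - cnj a * a) / (1 - cnj a * z)\<^sup>2) (at z)"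
proof -
  have "((\<lambda>z. (z - a) / (1 - cnj a * z)) has_field_derivative (1 - cnj a * a) / (1 - cnj a * z)\<^sup>2) (at z)"
    using one_minus_cnj_mult_nonzero [OF assms]
    by (auto intro!: derivative_eq_intros simp: power2_eq_square algebra_simps)
  then show ?thesis by (simp add: Moebius_function_def)
qed

text \<open>Disc automorphisms move \<open>z\<close> and \<open>f z\<close> to the origin, where the
  Schwarz lemma bounds the derivative by 1; the chain rule turns that bound into the claim.\<close>

lemma Schwarz_Pick_deriv:
  assumes holf: "f holomorphic_on unit_disc" and fD: "f ` unit_disc \<subseteq> unit_disc" and z: "z \<in> unit_disc"
  shows "norm (deriv f z) * (1 - (norm z)\<^sup>2) \<le> 1 - (norm (f z))\<^sup>2"
proof -
  define b where "b = f z"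
  have nz: "norm z < 1" and nb: "norm b < 1"
    using z fD by (auto simp: b_def image_subset_iff)
  \<comment> \<open>\<open>Moebius_function 0 (- z)\<close> sends 0 to \<open>z\<close>, and
    \<open>Moebius_function 0 b\<close> sends \<open>b = f z\<close> to 0, so \<open>G\<close> fixes
    0.\<close>
  define G where "G = Moebius_function 0 b \<circ> (f \<circ> Moebius_function 0 (- z))"
  have M0: "Moebius_function 0 (- z) 0 = z" by (simp add: Moebius_function_def)
  have hol: "G holomorphic_on unit_disc"
    unfolding G_def
  proof (intro holomorphic_on_compose_gen [where t = unit_disc])
    show "Moebius_function 0 (-z) holomorphic_on unit_disc" "Moebius_function 0 b holomorphic_on unit_disc"
      using nz nb by (auto intro!: Moebius_function_holomorphic)
    show "Moebius_function 0 (-z) ` unit_disc \<subseteq> unit_disc"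
      using nz by (auto intro!: Moebius_function_norm_lt_1)
    then show "(f \<circ> Moebius_function 0 (- z)) ` unit_disc \<subseteq> unit_disc"
      using fD by (auto simp: image_subset_iff)
  qed (use holf in auto)
  have nG: "norm (G w) < 1" if "norm w < 1" for w
    unfolding G_def o_def
    using fD Moebius_function_norm_lt_1 [of "-z" w 0] nz nb that
    by (intro Moebius_function_norm_lt_1) (auto simp: image_subset_iff)
  have G0: "G 0 = 0"
    by (simp add: G_def M0 b_def Moebius_function_eq_zero)
  have df: "(f has_field_derivative deriv f z) (at z)"
    using holf z holomorphic_derivI by blast
  have "(G has_field_derivative
      (1 - cnj b * b) / (1 - cnj b * b)\<^sup>2 * (deriv f z * ((1 - cnj (-z) * (-z)) / (1 - cnj (-z) * 0)\<^sup>2))) (at 0)"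
    unfolding G_def
  proof (rule DERIV_chain)
    show "(Moebius_function 0 b has_field_derivative (1 - cnj b * b) / (1 - cnj b * b)\<^sup>2)
            (at ((f \<circ> Moebius_function 0 (- z)) 0))"
      using has_field_derivative_Moebius_function [OF nb nb] by (simp add: M0 b_def)
    show "((f \<circ> Moebius_function 0 (- z)) has_field_derivative
       deriv f z * ((1 - cnj (- z) * - z) / (1 - cnj (- z) * 0)\<^sup>2)) (at 0)"
      by (rule DERIV_chain) (use df nz M0 has_field_derivative_Moebius_function [of "-z" 0] in auto)
  qed
  then have "deriv G 0 = (1 - cnj b * b) / (1 - cnj b * b)\<^sup>2 * (deriv f z * (1 - cnj z * z))"
    by (auto dest: DERIV_imp_deriv)
  also have "\<dots> = deriv f z * (1 - cnj z * z) / (1 - cnj b * b)"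
    using one_minus_cnj_mult_nonzero [OF nb nb] by (simp add: power2_eq_square)
  finally have "norm (deriv G 0) = norm (deriv f z) * norm (1 - cnj z * z) / norm (1 - cnj b * b)"
    by (simp add: norm_mult norm_divide)
  moreover have nn: "norm (1 - cnj w * w) = 1 - (norm w)\<^sup>2" if "norm w < 1" for w
  proof -
    have "1 - cnj w * w = of_real (1 - (norm w)\<^sup>2)"
      by (simp only: complex_norm_square of_real_diff of_real_1 mult.commute)
    then have "norm (1 - cnj w * w) = \<bar>1 - (norm w)\<^sup>2\<bar>" by (simp only: norm_of_real)
    then show ?thesis using that by (simp add: power_le_one)
  qed
  moreover have "norm (deriv G 0) \<le> 1"
    using Schwarz_Lemma(2) [OF hol G0 nG, of 0] by simp
  moreover have "1 - (norm b)\<^sup>2 > 0"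
    using nb by (simp add: power_less_one_iff abs_square_less_1)
  ultimately show ?thesis
    using nn [OF nz] nn [OF nb] by (simp only: b_def divide_le_eq_1_pos)
qed

text \<open>\<open>(l + 1) / (l - 1)\<close> is the Cayley transform from the left half-plane to the
  disc; the identity carries density computations from one domain to the other.\<close>

lemma Cayley_identity:
  fixes l :: complex
  assumes "l \<noteq> 1"
  shows "1 - (norm ((l + 1) / (l - 1)))\<^sup>2 = -4 * Re l / (norm (l - 1))\<^sup>2"
proof -
  have "1 - (norm ((l + 1) / (l - 1)))\<^sup>2 = ((norm (l - 1))\<^sup>2 - (norm (l + 1))\<^sup>2) / (norm (l - 1))\<^sup>2"
    using assms by (simp add: norm_divide power_divide diff_divide_distrib)
  also have "(norm (l - 1))\<^sup>2 - (norm (l + 1))\<^sup>2 = -4 * Re l"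
    unfolding cmod_power2 by (simp add: power2_eq_square algebra_simps)
  finally show ?thesis .
qed

text \<open>Composition with the Cayley transform gives a self-map of the disc. In its Schwarz-Pick
  inequality, rewritten by \<open>Cayley_identity\<close>, a common denominator cancels.\<close>

lemma left_half_plane_Schwarz_Pick:
  assumes holh: "h holomorphic_on unit_disc" and h: "\<And>z. z \<in> unit_disc \<Longrightarrow> Re (h z) \<le> 0"
    and z: "z \<in> unit_disc"
  shows "norm (deriv h z) * (1 - (norm z)\<^sup>2) \<le> 2 * - Re (h z)"
proof (rule field_le_epsilon)
  fix e :: real assume "e > 0"
  \<comment> \<open>\<open>Re (h w) = 0\<close> is allowed, so the values are first pushed into the
    open half-plane. The shift \<open>e/2\<close> returns as exactly \<open>e\<close> in the final
    bound.\<close>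
  define k where "k w = h w - of_real (e/2)" for w
  have holk: "k holomorphic_on unit_disc"
    unfolding k_def by (intro holomorphic_intros holh)
  have k: "Re (k w) < 0" if "w \<in> unit_disc" for w
    using h [OF that] \<open>e > 0\<close> by (simp add: k_def)
  define f where "f w = (k w + 1) / (k w - 1)" for w
  have k1: "k w \<noteq> 1" if "w \<in> unit_disc" for w
    using k [OF that] by auto
  have eq: "1 - (norm (f w))\<^sup>2 = -4 * Re (k w) / (norm (k w - 1))\<^sup>2" if "w \<in> unit_disc" for w
    unfolding f_def by (rule Cayley_identity [OF k1 [OF that]])
  have holf: "f holomorphic_on unit_disc"
    unfolding f_def by (intro holomorphic_intros holk) (use k1 in auto)
  have "f ` unit_disc \<subseteq> unit_disc"
  proof clarify
    fix w :: complex assume w: "w \<in> unit_disc"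
    have "1 - (norm (f w))\<^sup>2 > 0"
      unfolding eq [OF w] using k [OF w] k1 [OF w] by (intro divide_pos_pos) auto
    then show "f w \<in> unit_disc" by (simp add: abs_square_less_1)
  qed
  note SP = Schwarz_Pick_deriv [OF holf this z]
  have dk: "(k has_field_derivative deriv h z) (at z)"
    unfolding k_def by (auto intro!: derivative_eq_intros holomorphic_derivI [OF holh] z)
  have "(f has_field_derivative - 2 * deriv h z / (k z - 1)\<^sup>2) (at z)"
    unfolding f_def using k1 [OF z]
    by (auto intro!: derivative_eq_intros dk simp: power2_eq_square field_simps)
  then have "deriv f z = - 2 * deriv h z / (k z - 1)\<^sup>2"
    by (rule DERIV_imp_deriv)
  then have "2 * norm (deriv h z) / (norm (k z - 1))\<^sup>2 * (1 - (norm z)\<^sup>2)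
      \<le> -4 * Re (k z) / (norm (k z - 1))\<^sup>2"
    using SP eq [OF z] by (simp add: norm_divide norm_mult norm_power)
  then have "(2 * norm (deriv h z) * (1 - (norm z)\<^sup>2)) / (norm (k z - 1))\<^sup>2
      \<le> (-4 * Re (k z)) / (norm (k z - 1))\<^sup>2"
    by (simp only: times_divide_eq_left)
  then have "2 * norm (deriv h z) * (1 - (norm z)\<^sup>2) \<le> -4 * Re (k z)"
    using k1 [OF z] unfolding divide_le_cancel by auto
  then show "norm (deriv h z) * (1 - (norm z)\<^sup>2) \<le> 2 * - Re (h z) + e"
    by (simp add: k_def)
qed

text \<open>On the simply connected disc \<open>u = exp h\<close>, where
  \<open>Re h = ln (norm u)\<close> is nonpositive. Since \<open>u' = u * h'\<close>, the half-plane
  inequality for \<open>h\<close> bounds the logarithmic derivative of \<open>u\<close>.\<close>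

lemma Schwarz_Pick_nonvanishing:
  assumes holu: "u holomorphic_on unit_disc" and u0: "\<And>z. z \<in> unit_disc \<Longrightarrow> u z \<noteq> 0"
    and u1: "\<And>z. z \<in> unit_disc \<Longrightarrow> norm (u z) \<le> 1" and z: "z \<in> unit_disc"
  shows "norm (deriv u z) * (1 - (norm z)\<^sup>2) \<le> norm (u z) * (2 * - ln (norm (u z)))"
proof -
  have "simply_connected unit_disc" by (simp add: convex_imp_simply_connected)
  then obtain h where holh: "h holomorphic_on unit_disc" and h: "\<And>w. w \<in> unit_disc \<Longrightarrow> u w = exp (h w)"
    using simply_connected_eq_holomorphic_log [of unit_disc] holu u0 by blast
  have ln_u: "ln (norm (u w)) = Re (h w)" if "w \<in> unit_disc" for w
    by (simp add: h [OF that])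
  have le: "Re (h w) \<le> 0" if "w \<in> unit_disc" for w
    using u1 [OF that] h [OF that] by simp
  have "((\<lambda>w. exp (h w)) has_field_derivative u z * deriv h z) (at z)"
    using h [OF z] by (auto intro!: derivative_eq_intros holomorphic_derivI [OF holh] z)
  then have "(u has_field_derivative u z * deriv h z) (at z)"
    by (rule has_field_derivative_transform_within_open [OF _ open_ball z]) (simp add: h)
  then have "norm (deriv u z) = norm (u z) * norm (deriv h z)"
    by (simp add: DERIV_imp_deriv norm_mult)
  with mult_left_mono [OF left_half_plane_Schwarz_Pick [OF holh le z], of "norm (u z)"]
  show ?thesis by (simp add: ln_u [OF z] mult.assoc)
qed

text \<open>In the coordinate \<open>v = Moebius_function 0 a z\<close> the product is
  \<open>v\<close> times a holomorphic function. It vanishes at 0, so the Schwarz lemma allows the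
  factor \<open>v\<close> to be cancelled.\<close>

lemma Blaschke_division:
  assumes a: "a \<in> unit_disc" and holF: "F holomorphic_on unit_disc"
    and le: "\<And>z. z \<in> unit_disc \<Longrightarrow> norm (Moebius_function 0 a z * F z) \<le> 1"
    and z: "z \<in> unit_disc"
  shows "norm (F z) \<le> 1"
proof -
  have na: "norm a < 1" and nz: "norm z < 1" using a z by auto
  have *: "norm (F w) \<le> 1" if w: "w \<in> unit_disc" "w \<noteq> a" for w
  proof -
    have nw: "norm w < 1" using w by simp
    define \<phi> where "\<phi> = Moebius_function 0 a w"
    have \<phi>0: "\<phi> \<noteq> 0"
      using w one_minus_cnj_mult_nonzero [OF na nw] by (simp add: \<phi>_def Moebius_function_def)
    have n\<phi>: "norm \<phi> < 1" unfolding \<phi>_def by (intro Moebius_function_norm_lt_1 na nw)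
    define G where "G v = v * F (Moebius_function 0 (-a) v)" for v
    have im: "Moebius_function 0 (-a) ` unit_disc \<subseteq> unit_disc"
      using na by (auto intro!: Moebius_function_norm_lt_1)
    have "(F \<circ> Moebius_function 0 (-a)) holomorphic_on unit_disc"
      using im by (intro holomorphic_on_compose_gen [OF _ holF] Moebius_function_holomorphic) (use na in auto)
    then have holG: "G holomorphic_on unit_disc"
      unfolding G_def o_def by (intro holomorphic_intros)
    have G1: "norm (G v) \<le> 1" if "norm v < 1" for v
    proof -
      have "Moebius_function 0 (-a) v \<in> unit_disc" using im that by (auto simp: image_subset_iff)
      moreover have "Moebius_function 0 a (Moebius_function 0 (-a) v) = v"
        using Moebius_function_compose [of a "-a" v] na that by simp
      ultimately show ?thesis using le [of "Moebius_function 0 (-a) v"] by (simp add: G_def)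
    qed
    \<comment> \<open>\<open>Schwarz_Lemma\<close> asks for a bound strictly below 1, hence the
      scaling by \<open>c\<close>, removed afterwards by letting \<open>c\<close> tend to 1.\<close>
    have "c * norm (G \<phi>) \<le> norm \<phi>" if c: "0 < c" "c < 1" for c :: real
    proof -
      have "norm (of_real c * G \<phi>) \<le> norm \<phi>"
      proof (rule Schwarz_Lemma(1) [where f = "\<lambda>v. of_real c * G v"])
        show "(\<lambda>v. of_real c * G v) holomorphic_on unit_disc" by (intro holomorphic_intros holG)
        show "of_real c * G 0 = 0" by (simp add: G_def)
        show "norm (of_real c * G v) < 1" if "norm v < 1" for v
        proof -
          have "norm (of_real c * G v) = c * norm (G v)" using c by (simp add: norm_mult)
          also have "\<dots> \<le> c * 1" using G1 [OF that] c by (intro mult_left_mono) auto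
          finally show ?thesis using c by simp
        qed
      qed (rule n\<phi>)
      then show ?thesis using c by (simp add: norm_mult)
    qed
    then have "norm (G \<phi>) \<le> norm \<phi>"
      by (rule field_le_mult_one_interval)
    moreover have "Moebius_function 0 (-a) \<phi> = w"
      unfolding \<phi>_def using Moebius_function_compose [of "-a" a w] na nw by simp
    ultimately show ?thesis using \<phi>0 by (simp add: G_def norm_mult)
  qed
  show ?thesis
  proof (cases "z = a")
    case True
    \<comment> \<open>At \<open>a\<close> itself the Blaschke factor is 0 and cannot be cancelled;
      continuity of \<open>F\<close> supplies the bound.\<close>
    have "continuous_on unit_disc F" by (rule holomorphic_on_imp_continuous_on [OF holF])
    then have "(F \<longlongrightarrow> F a) (at a)"
      using a by (simp add: continuous_on_eq_continuous_at isContD)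
    then have "((\<lambda>w. norm (F w)) \<longlongrightarrow> norm (F a)) (at a)" by (rule tendsto_norm)
    moreover have "eventually (\<lambda>w. norm (F w) \<le> 1) (at a)"
      using * eventually_at_in_open [OF open_ball a] by (auto elim!: eventually_mono)
    ultimately show ?thesis
      using True by (auto intro: tendsto_upperbound)
  qed (use * z in auto)
qed

section \<open>The Schwarz-Pick lemma for zeros of high order\<close>

lemma higher_deriv_power_mult:
  assumes holW: "W holomorphic_on S" and S: "open S" "a \<in> S"
  shows "j < k \<Longrightarrow> (deriv ^^ j) (\<lambda>w. (w - a) ^ k * W w) a = 0"
    and "(deriv ^^ k) (\<lambda>w. (w - a) ^ k * W w) a = fact k * W a"
proof -
  \<comment> \<open>Up to order \<open>k\<close> only the \<open>k\<close>-th derivative of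
    \<open>(w - a) ^ k\<close> is nonzero at \<open>a\<close>, so at most the term
    \<open>i = k\<close> of the Leibniz sum survives.\<close>
  have pow: "(deriv ^^ i) (\<lambda>w. (w - a) ^ k) a = (if i = k then fact k else 0)" if "i \<le> k" for i
    using higher_deriv_power [of i a k a] that
    by (auto simp: pochhammer_fact)
  have eq: "(deriv ^^ j) (\<lambda>w. (w - a) ^ k * W w) a =
      (\<Sum>i = 0..j. of_nat (j choose i) * (deriv ^^ i) (\<lambda>w. (w - a) ^ k) a * (deriv ^^ (j - i)) W a)" for j
    by (rule higher_deriv_mult [OF _ holW S]) (intro holomorphic_intros)
  show "(deriv ^^ j) (\<lambda>w. (w - a) ^ k * W w) a = 0" if "j < k"
    unfolding eq using that by (intro sum.neutral) (auto simp: pow)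
  have "(deriv ^^ k) (\<lambda>w. (w - a) ^ k * W w) a =
      (\<Sum>i = 0..k. if i = k then fact k * W a else 0)"
    unfolding eq by (intro sum.cong) (auto simp: pow)
  then show "(deriv ^^ k) (\<lambda>w. (w - a) ^ k * W w) a = fact k * W a"
    by simp
qed

text \<open>The local factorisation at \<open>a\<close> extends to all of \<open>S\<close>, because
  away from \<open>a\<close> the cofactor is just \<open>g z / (z - a) ^ k\<close>.\<close>

lemma holomorphic_factor_zero_global:
  assumes holg: "g holomorphic_on S" and S: "open S" "connected S" and a: "a \<in> S" "g a = 0"
    and nonconst: "\<not> g constant_on S"
  obtains k q where "0 < k" "q holomorphic_on S" "q a \<noteq> 0" "\<And>z. z \<in> S \<Longrightarrow> g z = (z - a) ^ k * q z"
proof -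
  obtain h r k where k: "0 < k" and r: "0 < r" "ball a r \<subseteq> S" and holh: "h holomorphic_on ball a r"
    and gh: "\<And>w. w \<in> ball a r \<Longrightarrow> g w = (w - a) ^ k * h w" "\<And>w. w \<in> ball a r \<Longrightarrow> h w \<noteq> 0"
    using holomorphic_factor_zero_nonconstant [OF holg S a nonconst] by metis
  define q where "q z = (if z = a then h a else g z / (z - a) ^ k)" for z
  have "q holomorphic_on ball a r"
    by (rule holomorphic_transform [OF holh]) (simp add: q_def gh(1))
  moreover have "q holomorphic_on S - {a}"
  proof (rule holomorphic_transform)
    show "(\<lambda>z. g z / (z - a) ^ k) holomorphic_on S - {a}"
      by (intro holomorphic_intros holomorphic_on_subset [OF holg]) auto
  qed (auto simp: q_def)
  ultimately have "q holomorphic_on (ball a r \<union> (S - {a}))"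
    using S by (intro holomorphic_on_Un open_ball open_delete)
  moreover have "ball a r \<union> (S - {a}) = S" using r a by auto
  ultimately have "q holomorphic_on S" by simp
  moreover have "g z = (z - a) ^ k * q z" if "z \<in> S" for z
    using k a by (auto simp: q_def)
  moreover have "q a \<noteq> 0" using gh(2) r by (simp add: q_def)
  ultimately show ?thesis using that [OF k] by simp
qed

text \<open>Induction on the zero set: once the full power of \<open>z - a\<close> is divided out,
  \<open>q a \<noteq> 0\<close>, so exactly the zero \<open>a\<close> has disappeared.\<close>

lemma holomorphic_factor_finite_zeros:
  assumes "finite Z" and S: "open S" "connected S" "S \<noteq> {}"
    and "g holomorphic_on S" and "{z \<in> S. g z = 0} = Z"
  shows "\<exists>k U. U holomorphic_on S \<and> (\<forall>z\<in>S. U z \<noteq> 0) \<and> (\<forall>z\<in>S. g z = (\<Prod>a\<in>Z. (z - a) ^ k a) * U z)"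
  using assms(1,5,6)
proof (induction Z arbitrary: g rule: finite_induct)
  case empty
  then show ?case by auto
next
  case (insert a Z)
  have a: "a \<in> S" "g a = 0" using insert.prems by auto
  \<comment> \<open>A constant \<open>g\<close> with a zero vanishes on all of \<open>S\<close>, and
    a nonempty open set is infinite.\<close>
  have "\<not> g constant_on S"
  proof
    assume "g constant_on S"
    then have "{z \<in> S. g z = 0} = S" using a by (auto simp: constant_on_def)
    then have "S = insert a Z" using insert.prems by simp
    then have "finite S" using insert.hyps by simp
    then show False using S finite_imp_not_open by blast
  qed
  then obtain k q where k: "0 < k" and holq: "q holomorphic_on S" and qa: "q a \<noteq> 0"
    and gq: "\<And>z. z \<in> S \<Longrightarrow> g z = (z - a) ^ k * q z"
    using holomorphic_factor_zero_global [OF \<open>g holomorphic_on S\<close> S(1,2) a] by blast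
  have "z \<in> S \<and> q z = 0 \<longleftrightarrow> z \<in> Z" for z
  proof (cases "z = a")
    case False
    then have "z \<in> S \<and> q z = 0 \<longleftrightarrow> z \<in> S \<and> g z = 0" using gq by auto
    also have "\<dots> \<longleftrightarrow> z \<in> insert a Z" using insert.prems by blast
    finally show ?thesis using False by simp
  qed (use qa insert.hyps in auto)
  then have "{z \<in> S. q z = 0} = Z" by blast
  from insert.IH [OF holq this] obtain k' U where U: "U holomorphic_on S" "\<forall>z\<in>S. U z \<noteq> 0"
    and qU: "\<forall>z\<in>S. q z = (\<Prod>a\<in>Z. (z - a) ^ k' a) * U z" by blast
  have "(\<Prod>b\<in>Z. (z - b) ^ (k'(a := k)) b) = (\<Prod>b\<in>Z. (z - b) ^ k' b)" for z
    using insert.hyps by (intro prod.cong) auto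
  then have "\<forall>z\<in>S. g z = (\<Prod>b\<in>insert a Z. (z - b) ^ (k'(a := k)) b) * U z"
    using insert.hyps gq qU by (simp add: mult.assoc)
  with U show ?case by blast
qed

section \<open>Convexity inequalities for sinh\<close>

lemma sinh_superadditive:
  fixes x y :: real
  assumes "0 \<le> x" "0 \<le> y"
  shows "sinh x + sinh y \<le> sinh (x + y)"
proof -
  have "sinh x * 1 + 1 * sinh y \<le> sinh x * cosh y + cosh x * sinh y"
    using assms by (intro add_mono mult_mono cosh_real_ge_1) auto
  then show ?thesis by (simp add: sinh_add)
qed

text \<open>The left side minus the right side vanishes at 0 and decreases, since
  \<open>cosh t \<le> cosh (c * t)\<close>. It is applied with \<open>c = k / n\<close>, which is
  where zeros of order at least \<open>n\<close> enter.\<close>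

lemma sinh_mult_ge:
  fixes c x :: real
  assumes "1 \<le> c" "0 \<le> x"
  shows "c * sinh x \<le> sinh (c * x)"
proof -
  have "c * sinh 0 - sinh (c * 0) \<ge> c * sinh x - sinh (c * x)"
  proof (rule DERIV_nonpos_imp_nonincreasing [OF assms(2)])
    fix t :: real assume t: "0 \<le> t" "t \<le> x"
    have "t \<le> c * t" using assms t by (simp add: mult_le_cancel_right1)
    then have "cosh t \<le> cosh (c * t)"
      using t by (simp add: cosh_real_nonneg_le_iff)
    then have "c * cosh t - c * cosh (c * t) \<le> 0"
      using assms by (simp add: mult_left_mono)
    moreover have "((\<lambda>t. c * sinh t - sinh (c * t)) has_real_derivative c * cosh t - c * cosh (c * t)) (at t)"
      by (auto intro!: derivative_eq_intros)
    ultimately show "\<exists>y. ((\<lambda>t. c * sinh t - sinh (c * t)) has_real_derivative y) (at t) \<and> y \<le> 0"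
      by blast
  qed
  then show ?thesis by simp
qed

text \<open>Serves to weaken the linear bound of a zero-free function to the sinh form that the
  induction over Blaschke factors carries.\<close>

lemma le_sinh:
  fixes x :: real
  assumes "0 \<le> x"
  shows "x \<le> sinh x"
proof -
  have "0 - sinh 0 \<ge> x - sinh x"
  proof (rule DERIV_nonpos_imp_nonincreasing [OF assms])
    fix t :: real
    have "((\<lambda>t. t - sinh t) has_real_derivative 1 - cosh t) (at t)"
      by (auto intro!: derivative_eq_intros)
    then show "\<exists>y. ((\<lambda>t. t - sinh t) has_real_derivative y) (at t) \<and> y \<le> 0"
      using cosh_real_ge_1 [of t] by (intro exI [of _ "1 - cosh t"]) auto
  qed
  then show ?thesis by simp
qed

text \<open>With \<open>x = - ln \<bar>f z\<bar>\<close> the inequality for \<open>omega_density\<close> bounds the logarithmic derivative of \<open>f\<close>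
  by \<open>2 n sinh (x / n)\<close>. Logarithmic derivatives and the numbers \<open>x\<close> both add up under products,
  and sinh is superadditive, so Blaschke factors can be multiplied in one at a time.\<close>

lemma orb_Schwarz_Pick_step:
  fixes n :: real
  assumes n: "0 < n" "n \<le> real k" and a: "a \<in> unit_disc" and z: "z \<in> unit_disc" "z \<noteq> a"
    and holF: "F holomorphic_on unit_disc" and F: "F z \<noteq> 0" "norm (F z) \<le> 1"
    and bound: "norm (deriv F z) * (1 - (norm z)\<^sup>2) \<le> norm (F z) * (2 * n * sinh (- ln (norm (F z)) / n))"
  defines "f \<equiv> \<lambda>w. Moebius_function 0 a w ^ k * F w"
  shows "norm (deriv f z) * (1 - (norm z)\<^sup>2) \<le> norm (f z) * (2 * n * sinh (- ln (norm (f z)) / n))"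
proof -
  define m where "m = Moebius_function 0 a z"
  have na: "norm a < 1" and nz: "norm z < 1" using a z by auto
  have m0: "m \<noteq> 0"
    using z one_minus_cnj_mult_nonzero [OF na nz] by (simp add: m_def Moebius_function_def)
  have m1: "norm m < 1" unfolding m_def by (intro Moebius_function_norm_lt_1 na nz)
  have k0: "0 < k" using n by linarith
  have holM: "Moebius_function 0 a holomorphic_on unit_disc" 
    by (rule Moebius_function_holomorphic [OF na])
  have SP: "norm (deriv (Moebius_function 0 a) z) * (1 - (norm z)\<^sup>2) \<le> 1 - (norm m)\<^sup>2"
    unfolding m_def by (rule Schwarz_Pick_deriv [OF holM _ z(1)]) (auto intro!: Moebius_function_norm_lt_1 na)
  have "(f has_field_derivative
      of_nat k * deriv (Moebius_function 0 a) z * m ^ (k - 1) * F z + deriv F z * m ^ k) (at z)"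
    unfolding f_def m_def
    by (auto intro!: derivative_eq_intros holomorphic_derivI [OF holM open_ball z(1)]
        holomorphic_derivI [OF holF open_ball z(1)])
  then have df: "deriv f z = of_nat k * deriv (Moebius_function 0 a) z * m ^ (k - 1) * F z + deriv F z * m ^ k"
    by (rule DERIV_imp_deriv)
  define x where "x = - ln (norm m)"
  define y where "y = - ln (norm (F z))"
  have x: "x \<ge> 0" and y: "y \<ge> 0" using m0 m1 F by (auto simp: x_def y_def)
  \<comment> \<open>Turns the Schwarz-Pick bound \<open>SP\<close> into a bound by
    \<open>2 * sinh x\<close> on the weighted logarithmic derivative of the Blaschke factor.\<close>
  have m2: "1 - (norm m)\<^sup>2 = norm m * (2 * sinh x)"
    using m0 by (simp add: x_def sinh_ln_real power2_eq_square field_simps)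
  have z0: "0 \<le> 1 - (norm z)\<^sup>2" using nz by (simp add: power_le_one)
  have fz: "- ln (norm (f z)) = k * x + y"
    using m0 F by (simp add: f_def norm_mult norm_power ln_mult ln_realpow x_def y_def flip: m_def)
  have mk: "norm m ^ k = norm m ^ (k - 1) * norm m" using k0 by (metis power_minus_mult)
  have "norm (deriv f z) * (1 - (norm z)\<^sup>2) \<le>
     (real k * norm (deriv (Moebius_function 0 a) z) * norm m ^ (k - 1) * norm (F z) + norm (deriv F z) * norm m ^ k) * (1 - (norm z)\<^sup>2)"
    unfolding df using z0
    by (intro mult_right_mono order_trans [OF norm_triangle_ineq]) (auto simp: norm_mult norm_power)
  also have "\<dots> = real k * norm m ^ (k - 1) * norm (F z) * (norm (deriv (Moebius_function 0 a) z) * (1 - (norm z)\<^sup>2))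
      + norm m ^ k * (norm (deriv F z) * (1 - (norm z)\<^sup>2))"
    by (simp add: algebra_simps)
  also have "\<dots> \<le> real k * norm m ^ (k - 1) * norm (F z) * (norm m * (2 * sinh x))
      + norm m ^ k * (norm (F z) * (2 * n * sinh (y / n)))"
    using SP bound unfolding m2 y_def by (intro add_mono mult_left_mono) auto
  also have "\<dots> = norm (f z) * (2 * n * (real k / n * sinh x + sinh (y / n)))"
    using n by (simp add: f_def norm_mult norm_power mk algebra_simps flip: m_def)
  \<comment> \<open>The ratio \<open>k / n \<ge> 1\<close> moves into the argument of sinh;
    superadditivity then merges the two terms.\<close>
  also have "\<dots> \<le> norm (f z) * (2 * n * (sinh (real k / n * x) + sinh (y / n)))"
    using n x by (intro mult_left_mono add_right_mono sinh_mult_ge) auto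
  also have "\<dots> \<le> norm (f z) * (2 * n * sinh (real k / n * x + y / n))"
    using n x y by (intro mult_left_mono sinh_superadditive) auto
  also have "real k / n * x + y / n = - ln (norm (f z)) / n"
    unfolding fz by (simp add: add_divide_distrib)
  finally show ?thesis .
qed

text \<open>Supplies the bound by 1 that the Schwarz-Pick inequality for the zero-free cofactor
  requires. The outer induction removes points, the inner one lowers the exponent of a
  point.\<close>

lemma Blaschke_division_prod:
  assumes "finite A" "A \<subseteq> unit_disc" "U holomorphic_on unit_disc"
    and "\<And>z. z \<in> unit_disc \<Longrightarrow> norm ((\<Prod>a\<in>A. Moebius_function 0 a z ^ k a) * U z) \<le> 1"
    and "z \<in> unit_disc"
  shows "norm (U z) \<le> 1"
  using assms
proof (induction A arbitrary: U z rule: finite_induct)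
  case (insert a A)
  have a: "a \<in> unit_disc" using insert.prems by auto
  then have holM: "Moebius_function 0 a holomorphic_on unit_disc"
    by (intro Moebius_function_holomorphic) auto
  \<comment> \<open>The power belonging to \<open>a\<close> is absorbed into the cofactor, so the
    induction hypothesis strips all other points first.\<close>
  have *: "norm (Moebius_function 0 a w ^ k a * U w) \<le> 1" if "w \<in> unit_disc" for w
  proof (rule insert.IH [where U = "\<lambda>w. Moebius_function 0 a w ^ k a * U w"])
    show "(\<lambda>w. Moebius_function 0 a w ^ k a * U w) holomorphic_on unit_disc"
      by (intro holomorphic_intros holM insert.prems)
    show "norm ((\<Prod>b\<in>A. Moebius_function 0 b v ^ k b) * (Moebius_function 0 a v ^ k a * U v)) \<le> 1"
      if "v \<in> unit_disc" for v
      using insert.prems(3) [OF that] insert.hyps by (simp add: mult_ac)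
  qed (use insert.prems that in auto)
  \<comment> \<open>Downward induction from \<open>j = k a\<close> to \<open>j = 0\<close>, with one
    use of \<open>Blaschke_division\<close> per step.\<close>
  have "\<forall>w\<in>unit_disc. norm (Moebius_function 0 a w ^ j * U w) \<le> 1" if "j \<le> k a" for j
    using that
  proof (induction rule: inc_induct)
    case (step j)
    show ?case
    proof
      fix w :: complex assume w: "w \<in> unit_disc"
      show "norm (Moebius_function 0 a w ^ j * U w) \<le> 1"
      proof (rule Blaschke_division [OF a _ _ w, where F = "\<lambda>w. Moebius_function 0 a w ^ j * U w"])
        show "(\<lambda>w. Moebius_function 0 a w ^ j * U w) holomorphic_on unit_disc"
          by (intro holomorphic_intros holM insert.prems)
        show "norm (Moebius_function 0 a v * (Moebius_function 0 a v ^ j * U v)) \<le> 1" if "v \<in> unit_disc" for v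
          using step.IH that by (simp add: mult.assoc)
      qed
    qed
  qed (use * in auto)
  from this [of 0] show ?case using insert.prems(4) by simp
qed auto

text \<open>The base case is the zero-free bound weakened by \<open>le_sinh\<close>; each further
  point is one use of \<open>orb_Schwarz_Pick_step\<close>.\<close>

lemma orb_Schwarz_Pick_Blaschke_prod:
  fixes n :: real
  assumes n: "0 < n"
    and "finite A" "A \<subseteq> unit_disc" "\<And>a. a \<in> A \<Longrightarrow> n \<le> real (k a)"
    and U: "U holomorphic_on unit_disc" "\<And>w. w \<in> unit_disc \<Longrightarrow> U w \<noteq> 0"
      "\<And>w. w \<in> unit_disc \<Longrightarrow> norm (U w) \<le> 1"
    and z: "z \<in> unit_disc" and "z \<notin> A"
  defines "f \<equiv> \<lambda>A w. (\<Prod>a\<in>A. Moebius_function 0 a w ^ k a) * U w"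
  shows "norm (deriv (f A) z) * (1 - (norm z)\<^sup>2)
    \<le> norm (f A z) * (2 * n * sinh (- ln (norm (f A z)) / n))"
  using assms(2,3,4,9)
proof (induction A rule: finite_induct)
  case empty
  have "norm (deriv U z) * (1 - (norm z)\<^sup>2) \<le> norm (U z) * (2 * n * (- ln (norm (U z)) / n))"
    using Schwarz_Pick_nonvanishing [OF U z] n by simp
  also have "\<dots> \<le> norm (U z) * (2 * n * sinh (- ln (norm (U z)) / n))"
    using n U z by (intro mult_left_mono le_sinh) (auto simp: divide_nonpos_pos)
  finally show ?case by (simp add: f_def)
next
  case (insert a A)
  have a: "a \<in> unit_disc" "n \<le> real (k a)" "z \<noteq> a" using insert.prems by auto
  have M: "Moebius_function 0 b holomorphic_on unit_disc"
      "\<And>w. w \<in> unit_disc \<Longrightarrow> norm (Moebius_function 0 b w) < 1" if "b \<in> unit_disc" for b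
    using that by (auto intro!: Moebius_function_holomorphic Moebius_function_norm_lt_1)
  have hol: "f A holomorphic_on unit_disc"
    unfolding f_def using insert.prems by (auto intro!: holomorphic_intros U M)
  have "Moebius_function 0 b z \<noteq> 0" if "b \<in> A" for b
  proof -
    have "norm b < 1" "z \<noteq> b" using insert.prems that by auto
    then show ?thesis
      using one_minus_cnj_mult_nonzero [of b z] z by (simp add: Moebius_function_def)
  qed
  then have f0: "f A z \<noteq> 0" using U z insert.hyps by (auto simp: f_def)
  have "norm (Moebius_function 0 b z ^ k b) \<le> 1" if "b \<in> A" for b
    unfolding norm_power using M(2) [of b z] insert.prems z that
    by (intro power_le_one) (auto intro: less_imp_le)
  then have "norm (f A z) \<le> 1 * 1"
    unfolding f_def norm_mult prod_norm [symmetric] using U z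
    by (intro mult_mono prod_le_1) auto
  then have "norm (deriv (\<lambda>w. Moebius_function 0 a w ^ k a * f A w) z) * (1 - (norm z)\<^sup>2)
    \<le> norm (Moebius_function 0 a z ^ k a * f A z) * (2 * n * sinh (- ln (norm (Moebius_function 0 a z ^ k a * f A z)) / n))"
    using insert.prems
    by (intro orb_Schwarz_Pick_step [OF n a(2,1) z a(3) hol f0] insert.IH) auto
  moreover have "(\<lambda>w. Moebius_function 0 a w ^ k a * f A w) = f (insert a A)"
    using insert.hyps by (simp add: f_def mult.assoc)
  ultimately show ?case by (simp add: fun_eq_iff)
qed

text \<open>Finitely many zeros make \<open>g\<close> a finite Blaschke product times a zero-free
  function bounded by 1; \<open>ord\<close> forces every exponent to be at least
  \<open>n\<close>.\<close>

lemma orb_Schwarz_Pick_finite_zeros: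
  assumes n: "0 < n" and holg: "g holomorphic_on unit_disc" and g1: "\<And>w. w \<in> unit_disc \<Longrightarrow> norm (g w) \<le> 1"
    and fin: "finite {w \<in> unit_disc. g w = 0}"
    and ord: "\<And>a j. a \<in> unit_disc \<Longrightarrow> g a = 0 \<Longrightarrow> j < n \<Longrightarrow> (deriv ^^ j) g a = 0"
    and z: "z \<in> unit_disc" "g z \<noteq> 0"
  shows "norm (deriv g z) * (1 - (norm z)\<^sup>2) \<le> norm (g z) * (2 * real n * sinh (- ln (norm (g z)) / real n))"
proof -
  define A where "A = {w \<in> unit_disc. g w = 0}"
  have A: "finite A" "A \<subseteq> unit_disc" "z \<notin> A" using fin z by (auto simp: A_def)
  obtain k V where holV: "V holomorphic_on unit_disc" and V0: "\<And>w. w \<in> unit_disc \<Longrightarrow> V w \<noteq> 0"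
    and gV: "\<And>w. w \<in> unit_disc \<Longrightarrow> g w = (\<Prod>a\<in>A. (w - a) ^ k a) * V w"
  proof -
    have "unit_disc \<noteq> {}" by simp
    from holomorphic_factor_finite_zeros [OF A(1) open_ball connected_ball this holg A_def [symmetric]]
    show ?thesis using that by blast
  qed
  have nk: "n \<le> k a" if a: "a \<in> A" for a
  proof (rule ccontr)
    assume "\<not> n \<le> k a"
    \<comment> \<open>An exponent below \<open>n\<close> makes this derivative vanish, yet the
      Leibniz computation gives it the nonzero value \<open>fact (k a) * W a\<close>.\<close>
    then have "(deriv ^^ k a) g a = 0" using ord a by (auto simp: A_def)
    define W where "W w = (\<Prod>b\<in>A - {a}. (w - b) ^ k b) * V w" for w
    have holW: "W holomorphic_on unit_disc"
      unfolding W_def by (intro holomorphic_intros holV)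
    have aD: "a \<in> unit_disc" using a A by auto
    have "W a \<noteq> 0" using V0 [OF aD] A by (auto simp: W_def)
    moreover have "g w = (w - a) ^ k a * W w" if "w \<in> unit_disc" for w
      using gV [OF that] prod.remove [OF A(1) a, of "\<lambda>b. (w - b) ^ k b"] by (simp add: W_def)
    then have "(deriv ^^ k a) g a = (deriv ^^ k a) (\<lambda>w. (w - a) ^ k a * W w) a"
      by (intro higher_deriv_transform_within_open [OF holg _ open_ball aD])
         (auto intro!: holomorphic_intros holW)
    ultimately show False
      using higher_deriv_power_mult(2) [OF holW open_ball aD, of "k a"] \<open>(deriv ^^ k a) g a = 0\<close> by simp
  qed
  \<comment> \<open>The denominators of the Blaschke factors move into the cofactor; they have no
    zeros in the disc, so \<open>U\<close> stays zero-free.\<close>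
  define U where "U w = V w * (\<Prod>a\<in>A. (1 - cnj a * w) ^ k a)" for w
  have holU: "U holomorphic_on unit_disc" unfolding U_def by (intro holomorphic_intros holV)
  have nz: "1 - cnj a * w \<noteq> 0" if "a \<in> A" "w \<in> unit_disc" for a w
    using that A by (intro one_minus_cnj_mult_nonzero) auto
  then have U0: "U w \<noteq> 0" if "w \<in> unit_disc" for w
    using that V0 A by (auto simp: U_def)
  have gU: "g w = (\<Prod>a\<in>A. Moebius_function 0 a w ^ k a) * U w" if w: "w \<in> unit_disc" for w
  proof -
    have "(\<Prod>a\<in>A. Moebius_function 0 a w ^ k a) * (\<Prod>a\<in>A. (1 - cnj a * w) ^ k a) = (\<Prod>a\<in>A. (w - a) ^ k a)"
      unfolding prod.distrib [symmetric]
    proof (intro prod.cong refl)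
      fix a assume "a \<in> A"
      then have "Moebius_function 0 a w * (1 - cnj a * w) = w - a"
        using nz w by (simp add: Moebius_function_def)
      then show "Moebius_function 0 a w ^ k a * (1 - cnj a * w) ^ k a = (w - a) ^ k a"
        by (metis power_mult_distrib)
    qed
    then show ?thesis using gV [OF w] by (simp add: U_def mult.assoc mult.left_commute)
  qed
  have U1: "norm (U w) \<le> 1" if "w \<in> unit_disc" for w
    by (rule Blaschke_division_prod [OF A(1,2) holU _ that, where k = k]) (use g1 gU in auto)
  have "deriv g z = deriv (\<lambda>w. (\<Prod>a\<in>A. Moebius_function 0 a w ^ k a) * U w) z"
    using eventually_nhds_in_open [OF open_ball z(1)] by (intro deriv_cong_ev) (auto elim!: eventually_mono simp: gU)
  moreover have "norm (deriv (\<lambda>w. (\<Prod>a\<in>A. Moebius_function 0 a w ^ k a) * U w) z) * (1 - (norm z)\<^sup>2)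
      \<le> norm ((\<Prod>a\<in>A. Moebius_function 0 a z ^ k a) * U z)
        * (2 * real n * sinh (- ln (norm ((\<Prod>a\<in>A. Moebius_function 0 a z ^ k a) * U z)) / real n))"
    by (rule orb_Schwarz_Pick_Blaschke_prod) (use n A nk holU U0 U1 z in simp_all)
  ultimately show ?thesis by (simp only: gU [OF z(1)])
qed

text \<open>Restricting to a smaller disc leaves only finitely many zeros; then let its radius tend to 1.\<close>

lemma orb_Schwarz_Pick_sinh:
  assumes n: "0 < n" and holg: "g holomorphic_on unit_disc" and g1: "\<And>w. w \<in> unit_disc \<Longrightarrow> norm (g w) \<le> 1"
    and ord: "\<And>a j. a \<in> unit_disc \<Longrightarrow> g a = 0 \<Longrightarrow> j < n \<Longrightarrow> (deriv ^^ j) g a = 0"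
    and z: "z \<in> unit_disc" "g z \<noteq> 0"
  shows "norm (deriv g z) * (1 - (norm z)\<^sup>2) \<le> norm (g z) * (2 * real n * sinh (- ln (norm (g z)) / real n))"
    (is "_ \<le> ?R")
proof -
  \<comment> \<open>The finite-zeros bound for the dilation \<open>h w = g (r * w)\<close> at the
    point \<open>z / r\<close>, where \<open>deriv h\<close> is
    \<open>r * deriv g z\<close>.\<close>
  have scaled: "r * norm (deriv g z) * (1 - (norm z / r)\<^sup>2) \<le> ?R" if r: "norm z < r" "r < 1" for r :: real
  proof -
    have r0: "0 < r" using r by (meson norm_ge_zero order_le_less_trans)
    define h where "h w = g (of_real r * w)" for w
    have im: "of_real r * w \<in> cball 0 r" "of_real r * w \<in> unit_disc" if "w \<in> unit_disc" for w :: complex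
    proof -
      have "norm (of_real r * w) \<le> r * 1"
        unfolding norm_mult using r0 that by (intro mult_mono) auto
      then show "of_real r * w \<in> cball 0 r" "of_real r * w \<in> unit_disc" using r by auto
    qed
    have hd: "(deriv ^^ j) h w = of_real r ^ j * (deriv ^^ j) g (of_real r * w)" if "w \<in> unit_disc" for j w
      unfolding h_def by (rule higher_deriv_compose_linear [OF holg open_ball open_ball that]) (use im in auto)
    have z': "z / of_real r \<in> unit_disc" "of_real r * (z / of_real r) = z"
      using r r0 by (auto simp: norm_divide)
    have "norm (deriv h (z / of_real r)) * (1 - (norm (z / of_real r))\<^sup>2)
      \<le> norm (h (z / of_real r)) * (2 * real n * sinh (- ln (norm (h (z / of_real r))) / real n))"
    proof (rule orb_Schwarz_Pick_finite_zeros [OF n])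
      show "h holomorphic_on unit_disc"
        unfolding h_def
        by (rule holomorphic_on_compose_gen [OF _ holg, unfolded o_def]) (use im in \<open>auto intro!: holomorphic_intros\<close>)
      \<comment> \<open>A nonconstant \<open>g\<close> has finitely many zeros in a compact disc; a
        constant one has none, as \<open>g z \<noteq> 0\<close>.\<close>
      have "\<not> g constant_on unit_disc \<or> {w \<in> cball 0 r. g w = 0} = {}"
        using z r by (force simp: constant_on_def)
      then have "finite {w \<in> cball 0 r. g w = 0}"
      proof
        assume "\<not> g constant_on unit_disc"
        then show ?thesis
          by (intro holomorphic_compact_finite_zeros [OF holg]) (use r in auto)
      next
        assume "{w \<in> cball 0 r. g w = 0} = {}"
        then show ?thesis by (simp only: finite.emptyI)
      qed
      moreover have "{w \<in> unit_disc. h w = 0} \<subseteq> (\<lambda>w. w / of_real r) ` {w \<in> cball 0 r. g w = 0}"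
      proof
        fix w assume w: "w \<in> {w \<in> unit_disc. h w = 0}"
        show "w \<in> (\<lambda>w. w / of_real r) ` {w \<in> cball 0 r. g w = 0}"
          by (rule image_eqI [of _ _ "of_real r * w"]) (use w im r0 in \<open>auto simp: h_def\<close>)
      qed
      ultimately show "finite {w \<in> unit_disc. h w = 0}"
        by (meson finite_imageI finite_subset)
      show "(deriv ^^ j) h a = 0" if "a \<in> unit_disc" "h a = 0" "j < n" for a j
        using that ord im by (simp add: hd h_def)
      show "norm (h w) \<le> 1" if "w \<in> unit_disc" for w
        using g1 im(2) [OF that] by (simp add: h_def)
      show "z / of_real r \<in> unit_disc" by (rule z')
      show "h (z / of_real r) \<noteq> 0" using z z' by (simp add: h_def)
    qed
    then show ?thesis
      using hd [OF z'(1), of 1] z'(2) r0 by (simp add: h_def norm_mult norm_divide)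
  qed
  have "((\<lambda>r. r * norm (deriv g z) * (1 - (norm z / r)\<^sup>2)) \<longlongrightarrow> 1 * norm (deriv g z) * (1 - (norm z / 1)\<^sup>2)) (at_left 1)"
    by (intro tendsto_intros) auto
  moreover have "eventually (\<lambda>r. r * norm (deriv g z) * (1 - (norm z / r)\<^sup>2) \<le> ?R) (at_left 1)"
    by (rule eventually_mono [OF eventually_at_left_real [of "norm z" 1]]) (use scaled z in \<open>simp_all del: sinh_minus\<close>)
  ultimately have "1 * norm (deriv g z) * (1 - (norm z / 1)\<^sup>2) \<le> ?R"
    by (rule tendsto_upperbound) (rule trivial_limit_at_left_real)
  then show ?thesis by simp
qed

section \<open>From the sinh bound to the metric omega\<close>

lemma enat_le_zero_mult_iff: "enat m \<le> zero_mult g a \<longleftrightarrow> (\<forall>j<m. (deriv ^^ j) g a = 0)"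
proof (cases "\<exists>k. (deriv ^^ k) g a \<noteq> 0")
  case True
  define l where "l = (LEAST k. (deriv ^^ k) g a \<noteq> 0)"
  have "(deriv ^^ l) g a \<noteq> 0" unfolding l_def using True by (rule LeastI_ex)
  moreover have "(deriv ^^ j) g a = 0" if "j < l" for j
    using not_less_Least that unfolding l_def by blast
  ultimately have "m \<le> l \<longleftrightarrow> (\<forall>j<m. (deriv ^^ j) g a = 0)"
    by (meson leI order_less_le_trans)
  then show ?thesis using True by (simp add: zero_mult_def l_def)
qed (simp add: zero_mult_def)

text \<open>For finite \<open>n\<close> the right-hand side of the sinh bound is exactly
  \<open>2 / omega_density n (g z)\<close>. For infinite \<open>n\<close> the map \<open>g\<close>
  is zero-free, and \<open>Schwarz_Pick_nonvanishing\<close> gives this quantity directly.\<close>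

lemma orb_morphism_Schwarz_Pick:
  assumes n: "1 \<le> n" and g: "orb_morphism n g" and z: "z \<in> unit_disc"
  shows "omega_density n (g z) * norm (deriv g z) \<le> 2 / (1 - (norm z)\<^sup>2)"
proof (cases "g z = 0")
  case True
  \<comment> \<open>Division by 0 and \<open>0 powr 0\<close> both yield 0, so the density is 0 at
    the origin for every \<open>n\<close>, including \<open>n = 1\<close>.\<close>
  then have "omega_density n (g z) = 0" by (simp add: omega_density_def split: enat.split)
  then show ?thesis using z by (simp add: power_le_one)
next
  case False
  define w where "w = norm (g z)"
  have hol: "g holomorphic_on unit_disc" and im: "g ` unit_disc \<subseteq> unit_disc"
    and n_inf: "n = \<infinity> \<longrightarrow> 0 \<notin> g ` unit_disc"
    and ord: "\<forall>x\<in>unit_disc. g x = 0 \<longrightarrow> n \<le> zero_mult g x"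
    using g unfolding orb_morphism_def by - (elim conjE, assumption)+
  have gD: "g v \<in> unit_disc" if "v \<in> unit_disc" for v
    using im that by (simp only: image_subset_iff)
  have w: "0 < w" "w < 1"
    using gD [OF z] False by (auto simp: w_def)
  have g1: "norm (g v) \<le> 1" if "v \<in> unit_disc" for v
    using gD [OF that] by simp
  have z0: "0 < 1 - (norm z)\<^sup>2" using z by (simp add: power_less_one_iff abs_square_less_1)
  have "norm (deriv g z) * (1 - (norm z)\<^sup>2) * omega_density n (g z) \<le> 2"
  proof (cases n)
    case (enat m)
    have m: "0 < m" using n enat by (simp add: one_enat_def)
    have "norm (deriv g z) * (1 - (norm z)\<^sup>2) \<le> w * (2 * real m * sinh (- ln w / real m))"
      unfolding w_def
    proof (rule orb_Schwarz_Pick_sinh [OF m hol g1 _ z False])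
      fix a j assume a: "a \<in> unit_disc" "g a = 0" "j < m"
      with ord enat have "enat m \<le> zero_mult g a" by blast
      with a show "(deriv ^^ j) g a = 0" by (simp add: enat_le_zero_mult_iff)
    qed
    also have "w * (2 * real m * sinh (- ln w / real m)) = w * (real m * (inverse (w powr (1 / m)) - w powr (1 / m)))"
    proof -
      define s where "s = w powr (1 / real m)"
      have "ln w / real m = ln s" using w by (simp add: s_def ln_powr)
      moreover have "sinh (ln s) = (s - inverse s) / 2" using w by (intro sinh_ln_real) (simp add: s_def)
      ultimately have "sinh (- ln w / real m) = (inverse s - s) / 2" by simp
      then have "w * (2 * real m * sinh (- ln w / real m)) = w * (2 * real m * ((inverse s - s) / 2))"
        by (simp only:)
      then show ?thesis unfolding s_def [symmetric] by simp
    qed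
    also have "\<dots> = 2 / omega_density n (g z)"
    proof -
      \<comment> \<open>\<open>s\<close> is the modulus of an \<open>m\<close>-th root of
        \<open>g z\<close>, that is, of a lift to the covering disc; the density becomes rational in
        \<open>w\<close> and \<open>s\<close>.\<close>
      define s where "s = w powr (1 / m)"
      have s: "0 < s" "s < 1" using w m powr_less_mono2 [of "1 / real m" w 1] by (auto simp: s_def)
      have "w powr (1 - 1 / real m) = w / s" using w by (simp add: powr_diff s_def)
      moreover have "w powr (2 / real m) = s\<^sup>2" using w by (simp add: s_def power2_eq_square flip: powr_add)
      ultimately have "omega_density n (g z) = 2 / (real m * (w / s) * (1 - s\<^sup>2))"
        by (simp add: omega_density_def enat flip: w_def)
      then show ?thesis
        using s m w unfolding s_def [symmetric] by (simp add: field_simps power2_eq_square)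
    qed
    finally have *: "norm (deriv g z) * (1 - (norm z)\<^sup>2) \<le> 2 / omega_density n (g z)" .
    have "w powr (2 / real m) < 1" using w m powr_less_mono2 [of "2 / real m" w 1] by simp
    then have "0 < omega_density n (g z)" using w m by (simp add: omega_density_def enat flip: w_def)
    with * show ?thesis by (simp add: pos_le_divide_eq)
  next
    case infinity
    define q where "q = w * (2 * - ln w)"
    have "norm (deriv g z) * (1 - (norm z)\<^sup>2) \<le> q"
      unfolding w_def q_def
    proof (rule Schwarz_Pick_nonvanishing [OF hol _ g1 z])
      have "0 \<notin> g ` unit_disc" using n_inf infinity by simp
      then show "g v \<noteq> 0" if "v \<in> unit_disc" for v using that by force
    qed
    moreover have "omega_density n (g z) = 2 / q"
      using w by (simp add: omega_density_def infinity ln_realpow abs_mult q_def flip: w_def)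
    moreover have "0 < q" using w by (simp add: q_def mult_pos_neg)
    ultimately show ?thesis by (simp add: pos_divide_le_eq)
  qed
  then show ?thesis using z0 by (simp add: pos_le_divide_eq mult_ac)
qed

section \<open>Path lengths and induced pseudo-distances\<close>

text \<open>The curves over which \<open>induced_dist\<close> takes its infimum, with endpoints as
  arguments. Integrability matters: the \<open>integral\<close> of a non-integrable speed is 0 and
  would pull the infimum down.\<close>

definition admissible_path :: "complex set \<Rightarrow> (complex \<Rightarrow> real) \<Rightarrow> complex \<Rightarrow> complex \<Rightarrow> (real \<Rightarrow> complex) \<Rightarrow> bool" where
  "admissible_path S \<rho> x y \<gamma> \<longleftrightarrow> valid_path \<gamma> \<and> path_image \<gamma> \<subseteq> S \<and> pathstart \<gamma> = x \<and> pathfinish \<gamma> = y \<and>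
     (\<lambda>t. \<rho> (\<gamma> t) * norm (vector_derivative \<gamma> (at t))) integrable_on {0..1}"

section \<open>Reversing, joining and cutting paths\<close>

lemma valid_path_differentiable:
  assumes "valid_path \<gamma>"
  obtains T where "finite T" "\<And>t. t \<in> {0..1} - T \<Longrightarrow> \<gamma> differentiable at t"
    "continuous_on ({0..1} - T) (\<lambda>t. vector_derivative \<gamma> (at t))"
  using assms by (auto simp: valid_path_def piecewise_C1_differentiable_on_def C1_differentiable_on_eq)

text \<open>The change of variables shared by reversal, concatenation and restriction: the factor
  \<open>\<bar>m\<bar>\<close> from the speed of \<open>\<sigma>\<close> cancels the one from the
  substitution. Agreement is asked only on the open interval, so the joint of two paths does no
  harm.\<close>

lemma has_integral_length_affine:
  fixes \<gamma> \<sigma> :: "real \<Rightarrow> complex"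
  assumes T: "finite T" "\<And>t. t \<in> {c..d} - T \<Longrightarrow> \<gamma> differentiable at t"
    and int: "((\<lambda>t. \<rho> (\<gamma> t) * norm (vector_derivative \<gamma> (at t))) has_integral i) {c..d}"
    and m: "m \<noteq> 0" and im: "(\<lambda>t. m * t + k) ` {a..b} = {c..d}"
    and \<sigma>: "\<And>t. t \<in> {a<..<b} \<Longrightarrow> \<sigma> t = \<gamma> (m * t + k)"
  shows "((\<lambda>t. \<rho> (\<sigma> t) * norm (vector_derivative \<sigma> (at t))) has_integral i) {a..b}"
proof -
  define f where "f = (\<lambda>t. \<rho> (\<gamma> t) * norm (vector_derivative \<gamma> (at t)))"
  have "(f has_integral i) (cbox c d)" using int by (simp add: f_def)
  from has_integral_affinity [OF this m, of k]
  have *: "((\<lambda>x. f (m * x + k)) has_integral i / \<bar>m\<bar>) ((\<lambda>x. (1 / m) * x + - ((1 / m) * k)) ` {c..d})"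
    by simp
  have "(\<lambda>x. (1 / m) * x + - ((1 / m) * k)) ` {c..d} = {a..b}"
    unfolding im [symmetric] image_image using m by (simp add: field_simps)
  with * have "((\<lambda>x. f (m * x + k)) has_integral i / \<bar>m\<bar>) {a..b}" by simp
  from has_integral_mult_right [OF this, of "\<bar>m\<bar>"]
  have "((\<lambda>x. \<bar>m\<bar> * f (m * x + k)) has_integral i) {a..b}" using m by simp
  then show ?thesis
  proof (rule has_integral_spike_finite [rotated 2])
    \<comment> \<open>Off this finite set \<open>\<sigma>\<close> agrees with the reparametrised
      path on a neighbourhood, so the chain rule gives its two-sided derivative.\<close>
    show "finite ({a, b} \<union> (\<lambda>t. m * t + k) -` T)"
      using T m by (auto intro!: finite_vimageI simp: inj_on_def)
    fix t assume t: "t \<in> {a..b} - ({a, b} \<union> (\<lambda>t. m * t + k) -` T)"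
    then have ab: "t \<in> {a<..<b}" by auto
    have "m * t + k \<in> {c..d} - T" using t unfolding im [symmetric] by auto
    then have "(\<gamma> has_vector_derivative vector_derivative \<gamma> (at (m * t + k))) (at (m * t + k))"
      using T by (simp add: vector_derivative_works)
    then have "((\<gamma> \<circ> (\<lambda>t. m * t + k)) has_vector_derivative m *\<^sub>R vector_derivative \<gamma> (at (m * t + k))) (at t)"
      by (intro vector_diff_chain_at) (auto intro!: derivative_eq_intros)
    then have "(\<sigma> has_vector_derivative m *\<^sub>R vector_derivative \<gamma> (at (m * t + k))) (at t)"
      by (rule has_vector_derivative_transform_within_open [OF _ open_greaterThanLessThan ab]) (simp add: \<sigma>)
    then show "\<rho> (\<sigma> t) * norm (vector_derivative \<sigma> (at t)) = \<bar>m\<bar> * f (m * t + k)"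
      by (simp add: vector_derivative_at \<sigma> [OF ab] f_def)
  qed
qed

lemma admissible_path_const:
  assumes "x \<in> S"
  shows "admissible_path S \<rho> x x (\<lambda>t. x)" "path_len \<rho> (\<lambda>t. x) = 0"
proof -
  have "valid_path (linepath x x)" by simp
  then have "valid_path (\<lambda>t. x)" by (simp add: linepath_refl)
  then show "admissible_path S \<rho> x x (\<lambda>t. x)"
    using assms by (auto simp: admissible_path_def path_image_def pathstart_def pathfinish_def)
qed (simp add: path_len_def)

lemma admissible_path_reverse:
  assumes "admissible_path S \<rho> x y \<gamma>"
  shows "admissible_path S \<rho> y x (reversepath \<gamma>)" "path_len \<rho> (reversepath \<gamma>) = path_len \<rho> \<gamma>"
proof -
  have \<gamma>: "valid_path \<gamma>" "((\<lambda>t. \<rho> (\<gamma> t) * norm (vector_derivative \<gamma> (at t))) has_integral path_len \<rho> \<gamma>) {0..1}"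
    using assms by (auto simp: admissible_path_def path_len_def has_integral_integral)
  obtain T where T: "finite T" "\<And>t. t \<in> {0..1} - T \<Longrightarrow> \<gamma> differentiable at t"
    using valid_path_differentiable [OF \<gamma>(1)] by metis
  have "(\<lambda>t::real. -1 * t + 1) ` {0..1} = {0..1}"
    using image_affinity_atLeastAtMost [of "-1" 1 0 "1::real"] by simp
  from has_integral_length_affine [OF T \<gamma>(2) _ this, of "reversepath \<gamma>"]
  have *: "((\<lambda>t. \<rho> (reversepath \<gamma> t) * norm (vector_derivative (reversepath \<gamma>) (at t))) has_integral path_len \<rho> \<gamma>) {0..1}"
    by (simp add: reversepath_def)
  then show "path_len \<rho> (reversepath \<gamma>) = path_len \<rho> \<gamma>"
    unfolding path_len_def [of \<rho> "reversepath \<gamma>"] by (rule integral_unique)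
  show "admissible_path S \<rho> y x (reversepath \<gamma>)"
    using assms * by (auto simp: admissible_path_def)
qed

lemma admissible_path_join:
  assumes "admissible_path S \<rho> x y \<gamma>" "admissible_path S \<rho> y z \<delta>"
  shows "admissible_path S \<rho> x z (\<gamma> +++ \<delta>)" "path_len \<rho> (\<gamma> +++ \<delta>) = path_len \<rho> \<gamma> + path_len \<rho> \<delta>"
proof -
  have \<gamma>: "valid_path \<gamma>" "((\<lambda>t. \<rho> (\<gamma> t) * norm (vector_derivative \<gamma> (at t))) has_integral path_len \<rho> \<gamma>) {0..1}"
    and \<delta>: "valid_path \<delta>" "((\<lambda>t. \<rho> (\<delta> t) * norm (vector_derivative \<delta> (at t))) has_integral path_len \<rho> \<delta>) {0..1}"
    using assms by (auto simp: admissible_path_def path_len_def has_integral_integral)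
  define \<sigma> where "\<sigma> = \<gamma> +++ \<delta>"
  obtain T where T: "finite T" "\<And>t. t \<in> {0..1} - T \<Longrightarrow> \<gamma> differentiable at t"
    using valid_path_differentiable [OF \<gamma>(1)] by metis
  obtain U where U: "finite U" "\<And>t. t \<in> {0..1} - U \<Longrightarrow> \<delta> differentiable at t"
    using valid_path_differentiable [OF \<delta>(1)] by metis
  have "(\<lambda>t::real. 2 * t + 0) ` {0..1/2} = {0..1}"
    using image_affinity_atLeastAtMost [of 2 0 0 "1/2::real"] by simp
  note im1 = this
  have 1: "((\<lambda>t. \<rho> (\<sigma> t) * norm (vector_derivative \<sigma> (at t))) has_integral path_len \<rho> \<gamma>) {0..1/2}"
    by (rule has_integral_length_affine [OF T \<gamma>(2) _ im1]) (auto simp: \<sigma>_def joinpaths_def)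
  have "(\<lambda>t::real. 2 * t + (-1)) ` {1/2..1} = {0..1}"
    using image_affinity_atLeastAtMost [of 2 "-1" "1/2" "1::real"] by simp
  note im2 = this
  have 2: "((\<lambda>t. \<rho> (\<sigma> t) * norm (vector_derivative \<sigma> (at t))) has_integral path_len \<rho> \<delta>) {1/2..1}"
    by (rule has_integral_length_affine [OF U \<delta>(2) _ im2]) (auto simp: \<sigma>_def joinpaths_def)
  have *: "((\<lambda>t. \<rho> (\<sigma> t) * norm (vector_derivative \<sigma> (at t))) has_integral path_len \<rho> \<gamma> + path_len \<rho> \<delta>) {0..1}"
    by (rule has_integral_combine [OF _ _ 1 2]) auto
  then show "path_len \<rho> (\<gamma> +++ \<delta>) = path_len \<rho> \<gamma> + path_len \<rho> \<delta>"
    unfolding path_len_def [of \<rho> "\<gamma> +++ \<delta>"] by (simp only: \<sigma>_def integral_unique)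
  show "admissible_path S \<rho> x z (\<gamma> +++ \<delta>)"
    using assms * by (auto simp: admissible_path_def \<sigma>_def path_image_join valid_path_join)
qed

text \<open>The ambient set is the image of the piece itself, so \<open>admissible_path_mono\<close>
  can place the piece in any set containing it, such as the punctured disc.\<close>

lemma admissible_path_subpath:
  assumes \<gamma>: "admissible_path S \<rho> x y \<gamma>" and uv: "u \<in> {0..1}" "v \<in> {0..1}" "u < v"
  shows "admissible_path (path_image (subpath u v \<gamma>)) \<rho> (\<gamma> u) (\<gamma> v) (subpath u v \<gamma>)"
    "path_len \<rho> (subpath u v \<gamma>) = integral {u..v} (\<lambda>t. \<rho> (\<gamma> t) * norm (vector_derivative \<gamma> (at t)))" (is "_ = ?I")
proof -
  have vp: "valid_path \<gamma>" using \<gamma> by (simp add: admissible_path_def)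
  obtain T where T: "finite T" "\<And>t. t \<in> {0..1} - T \<Longrightarrow> \<gamma> differentiable at t"
    using valid_path_differentiable [OF vp] by metis
  have "(\<lambda>t. \<rho> (\<gamma> t) * norm (vector_derivative \<gamma> (at t))) integrable_on {u..v}"
    by (rule integrable_on_subinterval [of _ "{0..1}"]) (use \<gamma> uv in \<open>auto simp: admissible_path_def\<close>)
  then have int: "((\<lambda>t. \<rho> (\<gamma> t) * norm (vector_derivative \<gamma> (at t))) has_integral ?I) {u..v}"
    by (rule integrable_integral)
  have T': "\<gamma> differentiable at t" if "t \<in> {u..v} - T" for t
    using that uv T by auto
  have im: "(\<lambda>t. (v - u) * t + u) ` {0..1} = {u..v}"
    using image_affinity_atLeastAtMost [of "v - u" u 0 "1::real"] uv by simp
  have *: "((\<lambda>t. \<rho> (subpath u v \<gamma> t) * norm (vector_derivative (subpath u v \<gamma>) (at t))) has_integral ?I) {0..1}"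
    by (rule has_integral_length_affine [OF T(1) T' int _ im]) (use uv in \<open>auto simp: subpath_def\<close>)
  then show "path_len \<rho> (subpath u v \<gamma>) = ?I"
    unfolding path_len_def by (rule integral_unique)
  show "admissible_path (path_image (subpath u v \<gamma>)) \<rho> (\<gamma> u) (\<gamma> v) (subpath u v \<gamma>)"
    using vp uv * by (auto simp: admissible_path_def valid_path_subpath)
qed

section \<open>Infima of path lengths\<close>

lemma induced_dist_alt: "induced_dist S \<rho> x y = Inf (path_len \<rho> ` {\<gamma>. admissible_path S \<rho> x y \<gamma>})"
  unfolding induced_dist_def admissible_path_def by (rule arg_cong [where f = Inf]) auto

lemma path_len_nonneg:
  assumes "\<And>z. z \<in> S \<Longrightarrow> 0 \<le> \<rho> z" "admissible_path S \<rho> x y \<gamma>"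
  shows "0 \<le> path_len \<rho> \<gamma>"
  unfolding path_len_def
  by (rule integral_nonneg) (use assms in \<open>auto simp: admissible_path_def path_image_def image_subset_iff intro!: mult_nonneg_nonneg\<close>)

lemma induced_dist_le_path_len:
  assumes "\<And>z. z \<in> S \<Longrightarrow> 0 \<le> \<rho> z" "admissible_path S \<rho> x y \<gamma>"
  shows "induced_dist S \<rho> x y \<le> path_len \<rho> \<gamma>"
  unfolding induced_dist_alt
  by (rule cInf_lower) (use assms path_len_nonneg [of S \<rho>] in \<open>auto intro!: bdd_belowI [of _ 0]\<close>)

lemma induced_dist_greatest:
  assumes "admissible_path S \<rho> x y \<gamma>" "\<And>\<gamma>. admissible_path S \<rho> x y \<gamma> \<Longrightarrow> c \<le> path_len \<rho> \<gamma>"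
  shows "c \<le> induced_dist S \<rho> x y"
  unfolding induced_dist_alt by (rule cInf_greatest) (use assms in auto)

text \<open>Constant, reversed and joined paths give the three axioms; \<open>ex\<close> keeps every
  infimum over a nonempty set.\<close>

lemma pseudo_dist_on_induced_dist:
  assumes nonneg: "\<And>z. z \<in> S \<Longrightarrow> 0 \<le> \<rho> z"
    and ex: "\<And>x y. x \<in> S \<Longrightarrow> y \<in> S \<Longrightarrow> \<exists>\<gamma>. admissible_path S \<rho> x y \<gamma>"
  shows "pseudo_dist_on S (induced_dist S \<rho>)"
proof -
  note le = induced_dist_le_path_len [of S \<rho>, OF nonneg]
  have refl: "induced_dist S \<rho> x x = 0" if x: "x \<in> S" for x
  proof (rule antisym)
    show "induced_dist S \<rho> x x \<le> 0"
      using le [OF _ admissible_path_const(1) [OF x]] admissible_path_const(2) [OF x] by simp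
    show "0 \<le> induced_dist S \<rho> x x"
      by (rule induced_dist_greatest [OF admissible_path_const(1) [OF x]]) (rule path_len_nonneg [OF nonneg])
  qed
  have sym_le: "induced_dist S \<rho> x y \<le> induced_dist S \<rho> y x" if "x \<in> S" "y \<in> S" for x y
  proof -
    obtain \<gamma> where "admissible_path S \<rho> y x \<gamma>" using ex [OF \<open>y \<in> S\<close> \<open>x \<in> S\<close>] by blast
    then show ?thesis
    proof (rule induced_dist_greatest)
      fix \<gamma> assume "admissible_path S \<rho> y x \<gamma>"
      from admissible_path_reverse [OF this] show "induced_dist S \<rho> x y \<le> path_len \<rho> \<gamma>"
        using le by metis
    qed
  qed
  have triangle: "induced_dist S \<rho> x z \<le> induced_dist S \<rho> x y + induced_dist S \<rho> y z"
    if "x \<in> S" "y \<in> S" "z \<in> S" for x y z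
  proof -
    obtain \<gamma>0 where \<gamma>0: "admissible_path S \<rho> x y \<gamma>0" using ex [OF \<open>x \<in> S\<close> \<open>y \<in> S\<close>] by blast
    obtain \<delta>0 where \<delta>0: "admissible_path S \<rho> y z \<delta>0" using ex [OF \<open>y \<in> S\<close> \<open>z \<in> S\<close>] by blast
    \<comment> \<open>Two infima in turn: over \<open>\<gamma>\<close> with \<open>\<delta>\<close>
      fixed, then over \<open>\<delta>\<close>.\<close>
    have "induced_dist S \<rho> x z - induced_dist S \<rho> x y \<le> path_len \<rho> \<delta>"
      if \<delta>: "admissible_path S \<rho> y z \<delta>" for \<delta>
    proof -
      have "induced_dist S \<rho> x z - path_len \<rho> \<delta> \<le> induced_dist S \<rho> x y"
      proof (rule induced_dist_greatest [OF \<gamma>0])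
        fix \<gamma> assume "admissible_path S \<rho> x y \<gamma>"
        from admissible_path_join [OF this \<delta>] show "induced_dist S \<rho> x z - path_len \<rho> \<delta> \<le> path_len \<rho> \<gamma>"
          using le by (metis diff_le_eq)
      qed
      then show ?thesis by simp
    qed
    then have "induced_dist S \<rho> x z - induced_dist S \<rho> x y \<le> induced_dist S \<rho> y z"
      by (rule induced_dist_greatest [OF \<delta>0])
    then show ?thesis by simp
  qed
  show ?thesis
    unfolding pseudo_dist_on_def using refl sym_le triangle by (meson antisym)
qed

text \<open>The chain rule and \<open>le\<close> compare the speeds pointwise. Integrability of the
  new speed follows from this domination together with measurability.\<close>

lemma admissible_path_holomorphic_image:
  assumes \<gamma>: "admissible_path A \<sigma> x y \<gamma>" and A: "open A" and holg: "g holomorphic_on A"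
    and gA: "g ` A \<subseteq> S" and \<rho>: "\<rho> \<in> borel_measurable borel" and nonneg: "\<And>z. z \<in> S \<Longrightarrow> 0 \<le> \<rho> z"
    and le: "\<And>z. z \<in> A \<Longrightarrow> \<rho> (g z) * norm (deriv g z) \<le> \<sigma> z"
  shows "admissible_path S \<rho> (g x) (g y) (g \<circ> \<gamma>)" "path_len \<rho> (g \<circ> \<gamma>) \<le> path_len \<sigma> \<gamma>"
proof -
  let ?f = "\<lambda>t. \<rho> ((g \<circ> \<gamma>) t) * norm (vector_derivative (g \<circ> \<gamma>) (at t))"
  let ?h = "\<lambda>t. \<sigma> (\<gamma> t) * norm (vector_derivative \<gamma> (at t))"
  have vp: "valid_path \<gamma>" and im: "path_image \<gamma> \<subseteq> A" and int: "?h integrable_on {0..1}"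
    using \<gamma> by (auto simp: admissible_path_def)
  have vpg: "valid_path (g \<circ> \<gamma>)"
    by (rule valid_path_compose_holomorphic [OF vp holg A im])
  obtain T1 where T1: "finite T1" "\<And>t. t \<in> {0..1} - T1 \<Longrightarrow> \<gamma> differentiable at t"
    using valid_path_differentiable [OF vp] by metis
  obtain T2 where T2: "finite T2" "continuous_on ({0..1} - T2) (\<lambda>t. vector_derivative (g \<circ> \<gamma>) (at t))"
    using valid_path_differentiable [OF vpg] by metis
  \<comment> \<open>On \<open>K\<close> the chain rule applies and the derivative of
    \<open>g \<circ> \<gamma>\<close> is continuous; the finitely many removed points do not affect
    integrals.\<close>
  define K where "K = {0..1} - (T1 \<union> T2)"
  have neg: "negligible (({0..1} - K) \<union> (K - {0..1}))"
    by (rule negligible_subset [of "T1 \<union> T2"]) (use T1 T2 in \<open>auto simp: K_def negligible_finite\<close>)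
  have K_leb: "K \<in> sets lebesgue"
    unfolding K_def using T1 T2 by (intro sets.Diff lmeasurable_interval fmeasurableD negligible_imp_measurable negligible_finite) auto
  have \<gamma>A: "\<gamma> t \<in> A" if "t \<in> K" for t using that im by (auto simp: K_def path_image_def)
  have bound: "norm (?f t) \<le> ?h t" if t: "t \<in> K" for t
  proof -
    have "vector_derivative (g \<circ> \<gamma>) (at t) = vector_derivative \<gamma> (at t) * deriv g (\<gamma> t)"
      using t T1 \<gamma>A [OF t] holg A
      by (intro vector_derivative_chain_at_general) (auto simp: K_def holomorphic_on_imp_differentiable_at)
    then have "norm (?f t) = (\<rho> (g (\<gamma> t)) * norm (deriv g (\<gamma> t))) * norm (vector_derivative \<gamma> (at t))"
      using nonneg [of "g (\<gamma> t)"] gA \<gamma>A [OF t] by (auto simp: norm_mult)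
    also have "\<dots> \<le> ?h t" by (intro mult_right_mono le \<gamma>A t) auto
    finally show ?thesis .
  qed
  have hK: "?h integrable_on K" using int integrable_spike_set_eq [OF neg] by blast
  have cont: "continuous_on K (g \<circ> \<gamma>)"
    using valid_path_imp_path [OF vpg] by (auto simp: path_def K_def intro: continuous_on_subset)
  \<comment> \<open>Measurability comes from \<open>\<rho>\<close> being Borel rather than
    continuous, since \<open>omega_density\<close> is discontinuous at 0.\<close>
  have "(\<lambda>t. \<rho> ((g \<circ> \<gamma>) t)) \<in> borel_measurable (lebesgue_on K)"
    by (rule measurable_compose [OF continuous_imp_measurable_on_sets_lebesgue [OF cont K_leb] \<rho>])
  moreover have "continuous_on K (\<lambda>t. norm (vector_derivative (g \<circ> \<gamma>) (at t)))"
    by (intro continuous_on_norm continuous_on_subset [OF T2(2)]) (auto simp: K_def)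
  then have "(\<lambda>t. norm (vector_derivative (g \<circ> \<gamma>) (at t))) \<in> borel_measurable (lebesgue_on K)"
    by (rule continuous_imp_measurable_on_sets_lebesgue [OF _ K_leb])
  ultimately have "?f \<in> borel_measurable (lebesgue_on K)" by (rule borel_measurable_times)
  then have fK: "?f integrable_on K"
    by (rule measurable_bounded_by_integrable_imp_integrable [OF _ hK bound K_leb])
  then have "?f integrable_on {0..1}" using integrable_spike_set_eq [OF neg] by blast
  then show "admissible_path S \<rho> (g x) (g y) (g \<circ> \<gamma>)"
    using \<gamma> vpg gA im by (auto simp: admissible_path_def path_image_compose pathstart_compose pathfinish_compose)
  have "integral K ?f \<le> integral K ?h"
    by (rule integral_le [OF fK hK]) (use bound in fastforce)
  moreover have "integral {0..1} w = integral K w" for w :: "real \<Rightarrow> real"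
    by (rule integral_spike_set; rule negligible_subset [OF neg]) auto
  ultimately show "path_len \<rho> (g \<circ> \<gamma>) \<le> path_len \<sigma> \<gamma>"
    by (simp add: path_len_def)
qed

text \<open>\<open>L\<close> is the primitive of the logarithmic derivative, started at
  \<open>Ln (\<gamma> 0)\<close>; it follows the winding of the path, where
  \<open>Ln \<circ> \<gamma>\<close> would jump at the branch cut.\<close>

lemma valid_path_log:
  fixes \<gamma> :: "real \<Rightarrow> complex"
  assumes vp: "valid_path \<gamma>" and nz: "0 \<notin> path_image \<gamma>"
  obtains L T where "valid_path L" "\<And>t. t \<in> {0..1} \<Longrightarrow> exp (L t) = \<gamma> t" "finite T"
    "\<And>t. t \<in> {0..1} - T \<Longrightarrow> (L has_vector_derivative vector_derivative \<gamma> (at t) / \<gamma> t) (at t)"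
proof -
  obtain T0 where T0: "finite T0" "\<And>t. t \<in> {0..1} - T0 \<Longrightarrow> \<gamma> differentiable at t"
    "continuous_on ({0..1} - T0) (\<lambda>t. vector_derivative \<gamma> (at t))"
    using valid_path_differentiable [OF vp] by blast
  \<comment> \<open>The endpoints join the exceptional set, so that off \<open>T\<close> derivatives
    within \<open>{0..1}\<close> are two-sided.\<close>
  define T where "T = {0, 1} \<union> T0"
  have open_T: "{0..1} - T = {0<..<1} - T0" "open ({0<..<1} - T0)"
    using T0 by (auto simp: T_def finite_imp_closed open_Diff)
  define D where "D = (\<lambda>t. vector_derivative \<gamma> (at t) / \<gamma> t)"
  have \<gamma>0: "\<gamma> t \<noteq> 0" if "t \<in> {0..1}" for t using nz that by (auto simp: path_image_def)
  have pc: "\<gamma> piecewise_C1_differentiable_on {0..1}" using vp by (simp add: valid_path_def)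
  have cont\<gamma>: "continuous_on {0..1} \<gamma>" using valid_path_imp_path [OF vp] by (simp add: path_def)
  have int: "D integrable_on {0..1}"
    using winding_number_exp_integral(1) [OF pc, of 0] nz by (simp add: D_def path_image_def)
  define L where "L t = Ln (\<gamma> 0) + integral {0..t} D" for t
  have exp_L: "exp (L t) = \<gamma> t" if t: "t \<in> {0..1}" for t
  proof -
    have "\<gamma> piecewise_C1_differentiable_on {0..t}"
      by (rule piecewise_C1_differentiable_on_subset [OF pc]) (use t in auto)
    moreover have "0 \<notin> \<gamma> ` {0..t}" using \<gamma>0 t by force
    ultimately have "exp (- integral {0..t} D) * \<gamma> t = \<gamma> 0"
      using winding_number_exp_integral(2) [of \<gamma> 0 t 0] t by (simp add: D_def)
    then show ?thesis
      using \<gamma>0 [of 0] by (simp add: L_def exp_add exp_minus field_simps)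
  qed
  have contD: "continuous_on ({0..1} - T) D"
    unfolding D_def using \<gamma>0
    by (intro continuous_intros continuous_on_subset [OF T0(3)] continuous_on_subset [OF cont\<gamma>]) (auto simp: T_def)
  have der: "(L has_vector_derivative D t) (at t)" if t: "t \<in> {0..1} - T" for t
  proof -
    have "isCont D t"
      using contD t open_T by (metis continuous_on_eq_continuous_at)
    then have "continuous (at t within {0..1}) D" by (rule continuous_at_imp_continuous_at_within)
    then have "((\<lambda>u. integral {0..u} D) has_vector_derivative D t) (at t within {0..1})"
      using integral_has_vector_derivative_continuous_at [of D 0 1 t "{}"] int t by simp
    then have "(L has_vector_derivative D t) (at t within {0..1})"
      unfolding L_def by (auto intro!: derivative_eq_intros)
    moreover have "at t within {0..1} = at t"
      using t by (intro at_within_interior) (auto simp: T_def)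
    ultimately show ?thesis by simp
  qed
  have "finite T" using T0 by (simp add: T_def)
  have "continuous_on {0..1} L"
    unfolding L_def by (intro continuous_intros indefinite_integral_continuous_1 int)
  moreover have "L C1_differentiable_on {0..1} - T"
    unfolding C1_differentiable_on_def using der contD by blast
  ultimately have "valid_path L"
    using \<open>finite T\<close> unfolding valid_path_def piecewise_C1_differentiable_on_def by blast
  then show ?thesis
    by (rule that [OF _ exp_L \<open>finite T\<close>]) (use der in \<open>auto simp: D_def\<close>)
qed

section \<open>The covering of the orbifold disc\<close>

lemma admissible_path_mono: "admissible_path A \<rho> x y \<gamma> \<Longrightarrow> A \<subseteq> B \<Longrightarrow> admissible_path B \<rho> x y \<gamma>"
  by (auto simp: admissible_path_def)

lemma poincare_density_pos: "z \<in> unit_disc \<Longrightarrow> 0 < 2 / (1 - (norm z)\<^sup>2)"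
  by (simp add: abs_square_less_1)

lemma admissible_path_linepath:
  assumes "a \<in> unit_disc" "b \<in> unit_disc"
  shows "admissible_path unit_disc (\<lambda>z. 2 / (1 - (norm z)\<^sup>2)) a b (linepath a b)"
proof -
  have seg: "closed_segment a b \<subseteq> unit_disc"
    using assms by (simp add: closed_segment_subset)
  have "linepath a b t \<in> unit_disc" if "t \<in> {0..1}" for t
    using seg that by (metis linepath_in_path subsetD)
  then have "1 - (norm (linepath a b t))\<^sup>2 \<noteq> 0" if "t \<in> {0..1}" for t
    using poincare_density_pos [of "linepath a b t"] that by fastforce
  then have "continuous_on {0..1} (\<lambda>t. 2 / (1 - (norm (linepath a b t))\<^sup>2) * norm (vector_derivative (linepath a b) (at t)))"
    unfolding vector_derivative_linepath_at by (intro continuous_intros) auto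
  then show ?thesis
    using seg by (auto simp: admissible_path_def intro: integrable_continuous_interval)
qed

text \<open>Along the radial segment the density is largest at \<open>b\<close>. The bound is crude
  but tends to 0 with \<open>b\<close>, as the estimate near 0 requires.\<close>

lemma poincare_dist_0_le:
  assumes b: "b \<in> unit_disc"
  shows "poincare_dist b 0 \<le> 2 / (1 - (norm b)\<^sup>2) * norm b"
proof -
  let ?P = "\<lambda>z::complex. 2 / (1 - (norm z)\<^sup>2)"
  have adm: "admissible_path unit_disc ?P b 0 (linepath b 0)"
    by (rule admissible_path_linepath) (use b in auto)
  have "path_len ?P (linepath b 0) \<le> integral {0..1} (\<lambda>t::real. ?P b * norm b)"
    unfolding path_len_def
  proof (rule integral_le)
    fix t :: real assume t: "t \<in> {0..1}"
    have "norm (linepath b 0 t) = (1 - t) * norm b"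
      using t by (simp add: linepath_def)
    also have "\<dots> \<le> 1 * norm b" using t by (intro mult_right_mono) auto
    finally have "(norm (linepath b 0 t))\<^sup>2 \<le> (norm b)\<^sup>2" by simp
    then have "?P (linepath b 0 t) \<le> ?P b"
      using b by (intro divide_left_mono mult_pos_pos) (auto simp: abs_square_less_1 intro: le_less_trans)
    then show "?P (linepath b 0 t) * norm (vector_derivative (linepath b 0) (at t)) \<le> ?P b * norm b"
      unfolding vector_derivative_linepath_at using mult_right_mono [of _ _ "norm b"] by fastforce
  qed (use adm in \<open>auto simp: admissible_path_def\<close>)
  then show ?thesis
    unfolding poincare_dist_def
    using induced_dist_le_path_len [OF _ adm] poincare_density_pos by fastforce
qed

text \<open>The Cayley transform is its own inverse, so for infinite \<open>n\<close> the same
  fraction leads from the disc to the half-plane here and back again in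
  \<open>orb_log_lift\<close>.\<close>

definition orb_cover :: "enat \<Rightarrow> complex \<Rightarrow> complex" where
  "orb_cover n z = (case n of enat m \<Rightarrow> z ^ m | \<infinity> \<Rightarrow> exp ((z + 1) / (z - 1)))"

text \<open>The covering map expressed in the logarithmic coordinate of the left half-plane:
  \<open>orb_cover n \<circ> orb_log_lift n = exp\<close>.\<close>

definition orb_log_lift :: "enat \<Rightarrow> complex \<Rightarrow> complex" where
  "orb_log_lift n l = (case n of enat m \<Rightarrow> exp (l / of_nat m) | \<infinity> \<Rightarrow> (l + 1) / (l - 1))"

lemma orb_log_lift_in_unit_disc:
  assumes "1 \<le> n" "Re l < 0"
  shows "orb_log_lift n l \<in> unit_disc"
proof (cases n)
  case (enat m)
  then have "0 < m" using assms by (simp add: one_enat_def)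
  then show ?thesis using assms enat by (simp add: orb_log_lift_def divide_neg_pos)
next
  case infinity
  have "l \<noteq> 1" using assms by auto
  then have "0 < 1 - (norm ((l + 1) / (l - 1)))\<^sup>2"
    unfolding Cayley_identity [OF \<open>l \<noteq> 1\<close>] using assms by (intro divide_pos_pos) auto
  then show ?thesis using infinity by (simp add: orb_log_lift_def abs_square_less_1)
qed

lemma orb_log_lift_holomorphic: "orb_log_lift n holomorphic_on {l. Re l < 0}"
  by (cases n) (auto simp: orb_log_lift_def [abs_def] intro!: holomorphic_intros)

lemma orb_cover_log_lift:
  assumes "1 \<le> n" "Re l < 0"
  shows "orb_cover n (orb_log_lift n l) = exp l"
proof (cases n)
  case (enat m)
  then have "0 < m" using assms by (simp add: one_enat_def)
  then show ?thesis using enat by (simp add: orb_log_lift_def orb_cover_def flip: exp_of_nat_mult)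
next
  case infinity
  have "l - 1 \<noteq> 0" using assms by auto
  then have "((l + 1) / (l - 1) + 1) / ((l + 1) / (l - 1) - 1) = l"
    by (simp add: field_simps)
  then show ?thesis using infinity by (simp add: orb_log_lift_def orb_cover_def)
qed

text \<open>\<open>exp\<close> is its own derivative, so two pullbacks to the half-plane are
  compared: of the Poincare density by the lift and of omega by \<open>exp\<close>. Both are
  \<open>2 * s / (m * (1 - s\<^sup>2))\<close> with \<open>s = exp (Re l / m)\<close> for
  \<open>n = enat m\<close>, and \<open>1 / - Re l\<close> for infinite \<open>n\<close>.\<close>

lemma orb_log_lift_isometry:
  assumes "1 \<le> n" "Re l < 0"
  shows "2 / (1 - (norm (orb_log_lift n l))\<^sup>2) * norm (deriv (orb_log_lift n) l)
    = omega_density n (exp l) * norm (exp l)"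
proof (cases n)
  case (enat m)
  then have m: "0 < m" using assms by (simp add: one_enat_def)
  have "((\<lambda>l. exp (l / of_nat m)) has_field_derivative exp (l / of_nat m) / of_nat m) (at l)"
    using m by (auto intro!: derivative_eq_intros)
  then have d: "deriv (orb_log_lift n) l = exp (l / of_nat m) / of_nat m"
    using enat by (simp add: orb_log_lift_def [abs_def] DERIV_imp_deriv)
  define w where "w = exp (Re l)"
  define s where "s = exp (Re l / m)"
  have ws: "0 < w" "0 < s" by (simp_all add: w_def s_def)
  have s1: "s\<^sup>2 < 1"
    using assms m by (simp add: s_def divide_neg_pos abs_square_less_1)
  have "w powr (1 - 1 / real m) = w / s" using ws by (simp add: powr_def w_def s_def left_diff_distrib exp_diff)
  moreover have "w powr (2 / real m) = s\<^sup>2"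
    by (simp add: w_def s_def powr_def flip: exp_double)
  ultimately have "omega_density n (exp l) * norm (exp l) = 2 / (real m * (w / s) * (1 - s\<^sup>2)) * w"
    by (simp add: omega_density_def enat flip: w_def)
  also have "\<dots> = 2 / (1 - s\<^sup>2) * (s / m)"
    using ws s1 m by (simp add: field_simps)
  also have "\<dots> = 2 / (1 - (norm (orb_log_lift n l))\<^sup>2) * norm (deriv (orb_log_lift n) l)"
    unfolding d by (simp add: enat orb_log_lift_def s_def norm_divide)
  finally show ?thesis ..
next
  case infinity
  have l1: "l \<noteq> 1" using assms by auto
  have "((\<lambda>l. (l + 1) / (l - 1)) has_field_derivative - 2 / (l - 1)\<^sup>2) (at l)"
    using l1 by (auto intro!: derivative_eq_intros simp: power2_eq_square)
  then have d: "deriv (orb_log_lift n) l = - 2 / (l - 1)\<^sup>2"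
    using infinity by (simp add: orb_log_lift_def [abs_def] DERIV_imp_deriv)
  have "2 / (1 - (norm (orb_log_lift n l))\<^sup>2) * norm (deriv (orb_log_lift n) l)
     = 2 / (-4 * Re l / (norm (l - 1))\<^sup>2) * (2 / (norm (l - 1))\<^sup>2)"
    unfolding d Cayley_identity [OF l1, symmetric] by (simp add: infinity orb_log_lift_def norm_divide norm_power)
  also have "\<dots> = 1 / - Re l" using l1 assms by (simp add: field_simps)
  also have "\<dots> = omega_density n (exp l) * norm (exp l)"
    using assms by (simp add: omega_density_def infinity ln_realpow abs_mult)
  finally show ?thesis .
qed

lemma classical_orb_morphism_orb_cover:
  assumes "1 \<le> n"
  shows "classical_orb_morphism n (orb_cover n)"
proof (cases n)
  case (enat m)
  then have m: "0 < m" using assms by (simp add: one_enat_def)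
  have eq: "orb_cover n = (\<lambda>z. z ^ m)" by (simp add: orb_cover_def [abs_def] enat)
  have "zero_mult (\<lambda>z. z ^ m) 0 = enat m"
  proof -
    \<comment> \<open>The Leibniz lemma with \<open>W = 1\<close>: the first derivative of
      \<open>z ^ m\<close> that survives at 0 is the \<open>m\<close>-th.\<close>
    have d: "(deriv ^^ j) (\<lambda>z::complex. z ^ m) 0 = (if j = m then fact m else 0)" if "j \<le> m" for j
      using higher_deriv_power_mult [where W = "\<lambda>_. 1" and S = UNIV and a = 0 and k = m] that
      by (cases "j = m") auto
    then have "(LEAST j. (deriv ^^ j) (\<lambda>z::complex. z ^ m) 0 \<noteq> 0) = m"
      by (intro Least_equality) (auto intro: leI split: if_splits)
    moreover have "\<exists>j. (deriv ^^ j) (\<lambda>z::complex. z ^ m) 0 \<noteq> 0" using d [of m] by (intro exI [of _ m]) simp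
    ultimately show ?thesis by (simp add: zero_mult_def)
  qed
  moreover have "\<not> (\<lambda>z::complex. z ^ m) ` unit_disc \<subseteq> {0}"
  proof
    assume "(\<lambda>z::complex. z ^ m) ` unit_disc \<subseteq> {0}"
    moreover have "1/2 \<in> unit_disc" by simp
    ultimately have "(1/2 :: complex) ^ m = 0" by blast
    then show False by simp
  qed
  moreover have "(\<lambda>z::complex. z ^ m) ` unit_disc \<subseteq> unit_disc"
    using m by (auto simp: norm_power power_less_one_iff)
  moreover have "(\<lambda>z::complex. z ^ m) holomorphic_on unit_disc" by (intro holomorphic_intros)
  ultimately show ?thesis
    using m unfolding classical_orb_morphism_def eq by (auto simp: enat)
next
  case infinity
  have z1: "z \<noteq> 1" if "z \<in> unit_disc" for z :: complex using that by auto
  have eq: "orb_cover n = (\<lambda>z. exp ((z + 1) / (z - 1)))" by (simp add: orb_cover_def [abs_def] infinity)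
  have "Re ((z + 1) / (z - 1)) < 0" if z: "z \<in> unit_disc" for z
  proof -
    have "(z + 1) / (z - 1) = (z + 1) * cnj (z - 1) / (norm (z - 1))\<^sup>2"
      by (rule complex_div_cnj)
    then have "Re ((z + 1) / (z - 1)) = Re ((z + 1) * cnj (z - 1)) / (norm (z - 1))\<^sup>2"
      by (simp only: Re_divide_of_real)
    also have "Re ((z + 1) * cnj (z - 1)) = (norm z)\<^sup>2 - 1"
      unfolding cmod_power2 by (simp add: algebra_simps power2_eq_square)
    finally show ?thesis
      using z z1 [OF z] by (simp add: divide_neg_pos abs_square_less_1)
  qed
  then have "(\<lambda>z. exp ((z + 1) / (z - 1))) ` unit_disc \<subseteq> unit_disc" by auto
  moreover have "(\<lambda>z. exp ((z + 1) / (z - 1))) holomorphic_on unit_disc"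
    by (intro holomorphic_intros) (use z1 in auto)
  moreover have "\<not> (\<lambda>z::complex. exp ((z + 1) / (z - 1))) ` unit_disc \<subseteq> {0}"
    by (auto simp: image_subset_iff intro!: exI [of _ 0])
  ultimately show ?thesis
    unfolding classical_orb_morphism_def eq by (auto simp: infinity)
qed

lemma classical_orb_morphism_imp_orb_morphism:
  assumes n: "1 \<le> n" and g: "classical_orb_morphism n g"
  shows "orb_morphism n g"
proof -
  have "n \<le> zero_mult g x" if x: "x \<in> unit_disc" "g x = 0" for x
  proof -
    \<comment> \<open>A zero has order at least 1; this excludes the multiple \<open>k = 0\<close>
      of \<open>m\<close> and settles \<open>n = 1\<close>.\<close>
    have pos: "enat 1 \<le> zero_mult g x" using x by (simp only: enat_le_zero_mult_iff) simp
    have "\<forall>x\<in>unit_disc. g x = 0 \<longrightarrow> n = 1 \<or> (\<exists>m k. n = enat m \<and> zero_mult g x = enat k \<and> m dvd k)"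
      using g unfolding classical_orb_morphism_def by (elim conjE)
    with x have "n = 1 \<or> (\<exists>m k. n = enat m \<and> zero_mult g x = enat k \<and> m dvd k)"
      by blast
    then show ?thesis
    proof (elim disjE exE conjE)
      fix m k assume "n = enat m" "zero_mult g x = enat k" "m dvd k"
      then show ?thesis using pos by (auto dest: dvd_imp_le)
    qed (use pos in \<open>simp add: one_enat_def\<close>)
  qed
  then show ?thesis using g unfolding orb_morphism_def classical_orb_morphism_def by simp
qed

lemma orb_domain_subset: "orb_domain n \<subseteq> unit_disc"
  by (auto simp: orb_domain_def)

lemma orb_morphism_image: "orb_morphism n g \<Longrightarrow> g ` unit_disc \<subseteq> orb_domain n"
  unfolding orb_morphism_def orb_domain_def by auto

text \<open>A nonzero point is reached by lifting its logarithm, whose real part is negative; 0 lies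
  in the domain only for finite \<open>n\<close> and is then the image of 0.\<close>

lemma orb_cover_surj:
  assumes n: "1 \<le> n" and w: "w \<in> orb_domain n"
  obtains b where "b \<in> unit_disc" "orb_cover n b = w"
proof (cases "w = 0")
  case True
  then obtain m where "n = enat m" using w by (cases n) (auto simp: orb_domain_def)
  then show ?thesis using True n by (intro that [of 0]) (auto simp: orb_cover_def one_enat_def)
next
  case False
  then have "Re (Ln w) < 0" using w orb_domain_subset [of n] by (auto simp: subset_iff)
  then show ?thesis
    using orb_log_lift_in_unit_disc [OF n] orb_cover_log_lift [OF n] False
    by (intro that [of "orb_log_lift n (Ln w)"]) auto
qed

lemma omega_density_nonneg:
  assumes "z \<in> unit_disc"
  shows "0 \<le> omega_density n z"
proof (cases n)
  case (enat m)
  have "norm z powr (2 / real m) \<le> 1" using assms by (intro powr_le1) auto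
  then show ?thesis by (simp add: omega_density_def enat)
qed (simp add: omega_density_def)

lemma omega_density_borel [measurable]: "omega_density n \<in> borel_measurable borel"
  unfolding omega_density_def [abs_def] by (cases n) simp_all

section \<open>Maximality\<close>

lemma kob_admissible_le_poincare:
  assumes "kob_admissible S M d" "M g" "a \<in> unit_disc" "b \<in> unit_disc"
  shows "d (g a) (g b) \<le> poincare_dist a b"
  using assms by (simp add: kob_admissible_def)

lemma kob_admissible_pseudo_dist:
  assumes "kob_admissible S M d"
  shows "x \<in> S \<Longrightarrow> d x x = 0" "x \<in> S \<Longrightarrow> y \<in> S \<Longrightarrow> d x y = d y x"
    "x \<in> S \<Longrightarrow> y \<in> S \<Longrightarrow> z \<in> S \<Longrightarrow> d x z \<le> d x y + d y z"
  using assms unfolding kob_admissible_def pseudo_dist_on_def by blast+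

text \<open>A path avoiding 0 is the exponential of a path in the left half-plane, which \<open>orb_log_lift\<close> carries to
  a path of the same length in the disc.\<close>

lemma le_path_len_avoiding_0:
  assumes n: "1 \<le> n" and d: "kob_admissible (orb_domain n) (classical_orb_morphism n) d"
    and \<gamma>: "admissible_path (unit_disc - {0}) (omega_density n) x y \<gamma>"
  shows "d x y \<le> path_len (omega_density n) \<gamma>"
proof -
  let ?P = "\<lambda>z::complex. 2 / (1 - (norm z)\<^sup>2)"
  let ?c = "orb_log_lift n"
  have vp: "valid_path \<gamma>" and im: "path_image \<gamma> \<subseteq> unit_disc - {0}"
    and int: "(\<lambda>t. omega_density n (\<gamma> t) * norm (vector_derivative \<gamma> (at t))) integrable_on {0..1}"
    and ends: "\<gamma> 0 = x" "\<gamma> 1 = y"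
    using \<gamma> by (auto simp: admissible_path_def pathstart_def pathfinish_def)
  have "0 \<notin> path_image \<gamma>" using im by auto
  then obtain L T where L: "valid_path L" "\<And>t. t \<in> {0..1} \<Longrightarrow> exp (L t) = \<gamma> t" and T: "finite T"
    "\<And>t. t \<in> {0..1} - T \<Longrightarrow> (L has_vector_derivative vector_derivative \<gamma> (at t) / \<gamma> t) (at t)"
    using valid_path_log [OF vp] by metis
  have ReL: "Re (L t) < 0" if "t \<in> {0..1}" for t
  proof -
    have "\<gamma> t \<in> unit_disc" using im that unfolding path_image_def by blast
    then have "norm (exp (L t)) < 1" using L(2) [OF that] by simp
    then show ?thesis by simp
  qed
  have H: "open {l. Re l < 0}" by (rule open_halfspace_Re_lt)
  have vpc: "valid_path (?c \<circ> L)"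
    by (rule valid_path_compose_holomorphic [OF L(1) orb_log_lift_holomorphic H])
       (use ReL in \<open>auto simp: path_image_def\<close>)
  \<comment> \<open>The derivative of \<open>L\<close> is that of \<open>\<gamma>\<close> divided by
    \<open>\<gamma> t\<close>; the factor \<open>norm (\<gamma> t)\<close> from
    \<open>orb_log_lift_isometry\<close> cancels this division.\<close>
  have len_eq: "?P ((?c \<circ> L) t) * norm (vector_derivative (?c \<circ> L) (at t))
      = omega_density n (\<gamma> t) * norm (vector_derivative \<gamma> (at t))" if t: "t \<in> {0..1} - T" for t
  proof -
    have t01: "t \<in> {0..1}" using t by simp
    have "\<gamma> t \<noteq> 0" using L(2) [OF t01] by (metis exp_not_eq_zero)
    have "(?c has_field_derivative deriv ?c (L t)) (at (L t))"
      by (rule holomorphic_derivI [OF orb_log_lift_holomorphic H]) (simp add: ReL [OF t01])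
    then have "((?c \<circ> L) has_vector_derivative vector_derivative \<gamma> (at t) / \<gamma> t * deriv ?c (L t)) (at t)"
      by (rule field_vector_diff_chain_at [OF T(2) [OF t]])
    then have "norm (vector_derivative (?c \<circ> L) (at t))
        = norm (deriv ?c (L t)) * norm (vector_derivative \<gamma> (at t)) / norm (\<gamma> t)"
      by (simp add: vector_derivative_at norm_mult norm_divide)
    then have "?P ((?c \<circ> L) t) * norm (vector_derivative (?c \<circ> L) (at t))
        = ?P (?c (L t)) * norm (deriv ?c (L t)) * norm (vector_derivative \<gamma> (at t)) / norm (\<gamma> t)"
      by simp
    also have "\<dots> = omega_density n (\<gamma> t) * norm (\<gamma> t) * norm (vector_derivative \<gamma> (at t)) / norm (\<gamma> t)"
      by (simp only: orb_log_lift_isometry [OF n ReL [OF t01]] L(2) [OF t01])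
    finally show ?thesis using \<open>\<gamma> t \<noteq> 0\<close> by simp
  qed
  have "((\<lambda>t. ?P ((?c \<circ> L) t) * norm (vector_derivative (?c \<circ> L) (at t))) has_integral path_len (omega_density n) \<gamma>) {0..1}"
    unfolding path_len_def by (rule has_integral_spike_finite [OF T(1) len_eq integrable_integral [OF int]])
  then have int_c: "(\<lambda>t. ?P ((?c \<circ> L) t) * norm (vector_derivative (?c \<circ> L) (at t))) integrable_on {0..1}"
    and len: "path_len ?P (?c \<circ> L) = path_len (omega_density n) \<gamma>"
    unfolding path_len_def [of ?P] by (rule has_integral_integrable, rule integral_unique)
  have "path_image (?c \<circ> L) \<subseteq> unit_disc"
    unfolding path_image_def o_def by (intro image_subsetI orb_log_lift_in_unit_disc n ReL)
  then have "admissible_path unit_disc ?P (?c (L 0)) (?c (L 1)) (?c \<circ> L)"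
    using vpc int_c by (simp add: admissible_path_def pathstart_def pathfinish_def)
  then have "poincare_dist (?c (L 0)) (?c (L 1)) \<le> path_len ?P (?c \<circ> L)"
    unfolding poincare_dist_def
    by (rule induced_dist_le_path_len [rotated]) (rule less_imp_le [OF poincare_density_pos])
  \<comment> \<open>The cover sends the endpoints of the lifted path back to \<open>x\<close> and
    \<open>y\<close>, so admissibility of \<open>d\<close>, tested on the cover, closes the
    estimate.\<close>
  moreover have "orb_cover n (?c (L 0)) = x" "orb_cover n (?c (L 1)) = y"
    using orb_cover_log_lift [OF n ReL, of 0] orb_cover_log_lift [OF n ReL, of 1]
      L(2) [of 0] L(2) [of 1] ends by simp_all
  moreover have "d (orb_cover n (?c (L 0))) (orb_cover n (?c (L 1))) \<le> poincare_dist (?c (L 0)) (?c (L 1))"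
    by (rule kob_admissible_le_poincare [where g = "orb_cover n", OF d classical_orb_morphism_orb_cover [OF n]])
       (rule orb_log_lift_in_unit_disc [OF n ReL], simp)+
  ultimately show ?thesis by (simp only: len)
qed

text \<open>The cover itself is the test map: writing \<open>z = b ^ m\<close> gives
  \<open>d z 0 \<le> poincare_dist b 0\<close>, which is small with \<open>b\<close>.\<close>

lemma kob_admissible_small_near_0:
  assumes m: "0 < m" and d: "kob_admissible unit_disc (classical_orb_morphism (enat m)) d" and e: "0 < e"
  obtains r where "0 < r" "\<And>z. z \<in> unit_disc \<Longrightarrow> norm z < r \<Longrightarrow> d z 0 \<le> e"
proof -
  have "((\<lambda>t::real. 2 / (1 - t\<^sup>2) * t) \<longlongrightarrow> 2 / (1 - 0\<^sup>2) * 0) (at 0)"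
    by (intro tendsto_intros) auto
  then have "eventually (\<lambda>t::real. 2 / (1 - t\<^sup>2) * t < e) (at 0)"
    by (rule order_tendstoD(2)) (use e in simp)
  then obtain r where r: "0 < r" "\<forall>t::real. t \<noteq> 0 \<and> dist t 0 < r \<longrightarrow> 2 / (1 - t\<^sup>2) * t < e"
    unfolding eventually_at by (elim exE conjE) (use that in simp)
  \<comment> \<open>The radius \<open>r ^ m\<close> forces \<open>norm b < r\<close> for every
    \<open>m\<close>-th root \<open>b\<close> of \<open>z\<close>.\<close>
  have "d z 0 \<le> e" if z: "z \<in> unit_disc" "norm z < r ^ m" for z
  proof -
    have n: "1 \<le> enat m" using m by (simp add: one_enat_def)
    have "z \<in> orb_domain (enat m)" using z by (simp add: orb_domain_def)
    then obtain b where b: "b \<in> unit_disc" "orb_cover (enat m) b = z"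
      using orb_cover_surj [OF n] by blast
    have "b ^ m = z" using b(2) by (simp add: orb_cover_def)
    then have "norm b ^ m < r ^ m" using z(2) by (simp only: norm_power [symmetric])
    then have "norm b < r" using r(1) by (metis power_less_imp_less_base less_imp_le)
    then have "2 / (1 - (norm b)\<^sup>2) * norm b \<le> e"
      using r(2) [rule_format, of "norm b"] e by (cases "b = 0") (simp_all add: less_imp_le)
    with poincare_dist_0_le [OF b(1)] have "poincare_dist b 0 \<le> e" by simp
    moreover have "d (orb_cover (enat m) b) (orb_cover (enat m) 0) \<le> poincare_dist b 0"
      by (rule kob_admissible_le_poincare [where g = "orb_cover (enat m)", OF d classical_orb_morphism_orb_cover [OF n] b(1)]) simp
    moreover have "orb_cover (enat m) 0 = 0" using m by (simp add: orb_cover_def)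
    ultimately show ?thesis using b by simp
  qed
  then show ?thesis by (rule that [OF zero_less_power [OF r(1)]])
qed

text \<open>The logarithmic lift exists only before the path reaches 0. The path is stopped at a
  time \<open>s < 1\<close>, and the remaining gap from \<open>\<gamma> s\<close> to 0 costs at most
  \<open>e\<close>.\<close>

lemma le_path_len_ending_at_0:
  assumes m: "0 < m" and d: "kob_admissible unit_disc (classical_orb_morphism (enat m)) d"
    and \<gamma>: "admissible_path unit_disc (omega_density (enat m)) x 0 \<gamma>"
    and nz: "\<And>t. t \<in> {0..<1} \<Longrightarrow> \<gamma> t \<noteq> 0"
  shows "d x 0 \<le> path_len (omega_density (enat m)) \<gamma>"
proof (rule field_le_epsilon)
  fix e :: real assume e: "0 < e"
  let ?\<rho> = "omega_density (enat m)"
  have n: "1 \<le> enat m" using m by (simp add: one_enat_def)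
  have S: "orb_domain (enat m) = unit_disc" by (simp add: orb_domain_def)
  have im: "\<gamma> t \<in> unit_disc" if "t \<in> {0..1}" for t
    using \<gamma> that by (auto simp: admissible_path_def path_image_def image_subset_iff)
  have ends: "\<gamma> 0 = x" "\<gamma> 1 = 0" using \<gamma> by (auto simp: admissible_path_def pathstart_def pathfinish_def)
  have int: "(\<lambda>t. ?\<rho> (\<gamma> t) * norm (vector_derivative \<gamma> (at t))) integrable_on {0..1}"
    using \<gamma> by (simp add: admissible_path_def)
  obtain r where r: "0 < r" "\<And>z. z \<in> unit_disc \<Longrightarrow> norm z < r \<Longrightarrow> d z 0 \<le> e"
    using kob_admissible_small_near_0 [OF m d e] by blast
  have "continuous_on {0..1} \<gamma>"
    using \<gamma> valid_path_imp_path by (auto simp: admissible_path_def path_def)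
  then obtain \<eta> where \<eta>: "0 < \<eta>" "\<And>t. t \<in> {0..1} \<Longrightarrow> dist t 1 < \<eta> \<Longrightarrow> dist (\<gamma> t) (\<gamma> 1) < r"
    using r(1) unfolding continuous_on_iff by (metis atLeastAtMost_iff order_refl zero_le_one)
  \<comment> \<open>Closer to 1 than \<open>\<eta>\<close>, and positive so that
    \<open>{0..s}\<close> is a nondegenerate interval.\<close>
  define s where "s = max (1/2) (1 - \<eta> / 2)"
  have s: "0 < s" "s < 1" "dist s 1 < \<eta>" using \<eta>(1) by (auto simp: s_def dist_real_def)
  then have "norm (\<gamma> s) < r" using \<eta>(2) [of s] ends by simp
  then have small: "d (\<gamma> s) 0 \<le> e" using r(2) [of "\<gamma> s"] im s by simp
  have s01: "0 \<in> {0..1::real}" "s \<in> {0..1}" using s by auto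
  note sub = admissible_path_subpath [OF \<gamma> s01 s(1)]
  have "path_image (subpath 0 s \<gamma>) \<subseteq> unit_disc - {0}"
    unfolding path_image_subpath using s im nz by auto
  from le_path_len_avoiding_0 [OF n _ admissible_path_mono [OF sub(1) this]] d
  have "d x (\<gamma> s) \<le> path_len ?\<rho> (subpath 0 s \<gamma>)" by (simp add: S ends)
  also have "\<dots> \<le> path_len ?\<rho> \<gamma>"
    unfolding sub(2) unfolding path_len_def
  proof (rule integral_subset_le)
    show "(\<lambda>t. ?\<rho> (\<gamma> t) * norm (vector_derivative \<gamma> (at t))) integrable_on {0..s}"
      by (rule integrable_on_subinterval [OF int]) (use s in auto)
  qed (use s int im omega_density_nonneg in auto)
  finally have "d x (\<gamma> s) \<le> path_len ?\<rho> \<gamma>" .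
  moreover have "d x 0 \<le> d x (\<gamma> s) + d (\<gamma> s) 0"
    by (rule kob_admissible_pseudo_dist(3) [OF d]) (use im [of 0] im [of s] s01 ends in auto)
  ultimately show "d x 0 \<le> path_len ?\<rho> \<gamma> + e" using small by simp
qed

text \<open>Between its first and its last visit to 0 a path may be discarded, since \<open>d 0 0 = 0\<close>.\<close>

lemma le_path_len_through_0:
  assumes m: "0 < m" and d: "kob_admissible unit_disc (classical_orb_morphism (enat m)) d"
    and \<gamma>: "admissible_path unit_disc (omega_density (enat m)) x y \<gamma>"
    and "0 \<in> path_image \<gamma>"
  shows "d x y \<le> path_len (omega_density (enat m)) \<gamma>"
proof -
  let ?\<rho> = "omega_density (enat m)"
  let ?f = "\<lambda>t. ?\<rho> (\<gamma> t) * norm (vector_derivative \<gamma> (at t))"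
  define Z where "Z = {t \<in> {0..1}. \<gamma> t = 0}"
  have im: "\<gamma> t \<in> unit_disc" if "t \<in> {0..1}" for t
    using \<gamma> that by (auto simp: admissible_path_def path_image_def image_subset_iff)
  have ends: "\<gamma> 0 = x" "\<gamma> 1 = y" using \<gamma> by (auto simp: admissible_path_def pathstart_def pathfinish_def)
  have xy: "x \<in> unit_disc" "y \<in> unit_disc" using im [of 0] im [of 1] ends by auto
  have "0 \<in> unit_disc" by simp
  note pd = kob_admissible_pseudo_dist(1) [OF d this] kob_admissible_pseudo_dist(2) [OF d this xy(2)]
    kob_admissible_pseudo_dist(3) [OF d xy(1) this xy(2)]
  have int: "?f integrable_on {0..1}" using \<gamma> by (simp add: admissible_path_def)
  have sub_int: "?f integrable_on {u..v}" if "0 \<le> u" "v \<le> 1" for u v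
    by (rule integrable_on_subinterval [OF int]) (use that in auto)
  have nonneg: "0 \<le> integral {u..v} ?f" if "0 \<le> u" "v \<le> 1" for u v
    by (rule integral_nonneg [OF sub_int [OF that]])
       (use that im omega_density_nonneg in \<open>auto intro!: mult_nonneg_nonneg\<close>)
  have "continuous_on {0..1} \<gamma>"
    using \<gamma> valid_path_imp_path by (auto simp: admissible_path_def path_def)
  then have "closed Z"
    unfolding Z_def by (intro continuous_closed_preimage_constant) auto
  moreover have "bounded Z" by (rule bounded_subset [of "{0..1}"]) (auto simp: Z_def)
  ultimately have "compact Z" by (simp add: compact_eq_bounded_closed)
  have "Z \<noteq> {}" using assms(4) by (auto simp: Z_def path_image_def)
  obtain t0 where t0: "t0 \<in> Z" "\<And>t. t \<in> Z \<Longrightarrow> t0 \<le> t"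
    using compact_attains_inf [OF \<open>compact Z\<close> \<open>Z \<noteq> {}\<close>] by blast
  obtain t1 where t1: "t1 \<in> Z" "\<And>t. t \<in> Z \<Longrightarrow> t \<le> t1"
    using compact_attains_sup [OF \<open>compact Z\<close> \<open>Z \<noteq> {}\<close>] by blast
  have t01: "0 \<le> t0" "t0 \<le> t1" "t1 \<le> 1" "\<gamma> t0 = 0" "\<gamma> t1 = 0"
    using t0 t1 by (auto simp: Z_def)
  have first: "d x 0 \<le> integral {0..t0} ?f"
  proof (cases "t0 = 0")
    case True
    then show ?thesis using ends t01 pd by simp
  next
    case False
    then have "0 < t0" using t01 by simp
    have uv: "0 \<in> {0..1::real}" "t0 \<in> {0..1}" using t01 by auto
    note sub = admissible_path_subpath [OF \<gamma> uv \<open>0 < t0\<close>]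
    have "path_image (subpath 0 t0 \<gamma>) \<subseteq> unit_disc"
      unfolding path_image_subpath using t01 im by auto
    from admissible_path_mono [OF sub(1) this]
    have adm: "admissible_path unit_disc ?\<rho> x 0 (subpath 0 t0 \<gamma>)"
      by (simp add: ends t01)
    have "subpath 0 t0 \<gamma> t \<noteq> 0" if t: "t \<in> {0..<1}" for t
    proof
      assume "subpath 0 t0 \<gamma> t = 0"
      moreover have "t0 * t \<in> {0..1}" using t t01 by (auto intro: mult_le_one)
      ultimately have "t0 \<le> t0 * t" using t0(2) [of "t0 * t"] by (simp add: Z_def subpath_def)
      then show False using t \<open>0 < t0\<close> by (simp add: mult_le_cancel_left1)
    qed
    from le_path_len_ending_at_0 [OF m d adm this] show ?thesis by (simp add: sub(2))
  qed
  have last: "d y 0 \<le> integral {t1..1} ?f"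
  proof (cases "t1 = 1")
    case True
    then show ?thesis using ends t01 pd by simp
  next
    case False
    then have "t1 < 1" using t01 by simp
    have uv: "t1 \<in> {0..1}" "1 \<in> {0..1::real}" using t01 by auto
    note sub = admissible_path_subpath [OF \<gamma> uv \<open>t1 < 1\<close>]
    have "path_image (subpath t1 1 \<gamma>) \<subseteq> unit_disc"
      unfolding path_image_subpath using t01 im by auto
    \<comment> \<open>The final piece is traversed backwards, so that it too ends at 0.\<close>
    from admissible_path_reverse [OF admissible_path_mono [OF sub(1) this]]
    have adm: "admissible_path unit_disc ?\<rho> y 0 (subpath 1 t1 \<gamma>)"
      and len: "path_len ?\<rho> (subpath 1 t1 \<gamma>) = integral {t1..1} ?f"
      by (simp_all add: ends t01 sub(2) reversepath_subpath)
    have "subpath 1 t1 \<gamma> t \<noteq> 0" if t: "t \<in> {0..<1}" for t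
    proof
      define u where "u = (t1 - 1) * t + 1"
      have "(1 - t1) * t < (1 - t1) * 1" using t \<open>t1 < 1\<close> by (intro mult_strict_left_mono) auto
      moreover have "0 \<le> (1 - t1) * t" using t t01 by simp
      ultimately have u: "t1 < u" "u \<le> 1" by (auto simp: u_def algebra_simps)
      assume "subpath 1 t1 \<gamma> t = 0"
      then have "u \<in> Z" using u t01 by (auto simp: Z_def subpath_def u_def)
      then show False using t1(2) u by force
    qed
    from le_path_len_ending_at_0 [OF m d adm this] show ?thesis by (simp add: len)
  qed
  have "integral {0..1} ?f = integral {0..t0} ?f + integral {t0..1} ?f"
    by (rule Henstock_Kurzweil_Integration.integral_combine [symmetric]) (use t01 int in auto)
  moreover have "integral {t0..1} ?f = integral {t0..t1} ?f + integral {t1..1} ?f"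
    by (rule Henstock_Kurzweil_Integration.integral_combine [symmetric]) (use t01 sub_int in auto)
  ultimately show ?thesis
    using first last pd nonneg [of t0 t1] t01 by (simp add: path_len_def)
qed

text \<open>\<open>M\<close> is any class between the classical and the general orbifold morphisms.
  Admissibility uses only the Schwarz-Pick bound, valid for the larger class; maximality tests only
  with the cover, which lies in the smaller one.\<close>

lemma is_kobayashi_induced_dist_omega:
  assumes n: "1 \<le> n" and M: "\<And>g. classical_orb_morphism n g \<Longrightarrow> M g" "\<And>g. M g \<Longrightarrow> orb_morphism n g"
  shows "is_kobayashi (orb_domain n) M (induced_dist (orb_domain n) (omega_density n))"
proof -
  let ?S = "orb_domain n"
  let ?\<rho> = "omega_density n"
  have nonneg: "0 \<le> ?\<rho> z" if "z \<in> ?S" for z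
    using that orb_domain_subset [of n] by (intro omega_density_nonneg) auto
  have push: "admissible_path ?S ?\<rho> (g a) (g b) (g \<circ> \<gamma>) \<and> path_len ?\<rho> (g \<circ> \<gamma>) \<le> path_len (\<lambda>z. 2 / (1 - (norm z)\<^sup>2)) \<gamma>"
    if g: "orb_morphism n g" and \<gamma>: "admissible_path unit_disc (\<lambda>z. 2 / (1 - (norm z)\<^sup>2)) a b \<gamma>" for g a b \<gamma>
  proof -
    have "g holomorphic_on unit_disc" using g unfolding orb_morphism_def by (elim conjE)
    note * = admissible_path_holomorphic_image [OF \<gamma> open_ball this orb_morphism_image [OF g] omega_density_borel nonneg
        orb_morphism_Schwarz_Pick [OF n g]]
    show ?thesis by (intro conjI *)
  qed
  have orb: "orb_morphism n (orb_cover n)"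
    by (intro classical_orb_morphism_imp_orb_morphism classical_orb_morphism_orb_cover n)
  \<comment> \<open>Both points are lifted to the disc, joined there by a segment, and the segment
    is pushed down by the cover.\<close>
  have ex: "\<exists>\<gamma>. admissible_path ?S ?\<rho> x y \<gamma>" if xy: "x \<in> ?S" "y \<in> ?S" for x y
  proof -
    obtain a where a: "a \<in> unit_disc" "orb_cover n a = x" using orb_cover_surj [OF n xy(1)] by blast
    obtain b where b: "b \<in> unit_disc" "orb_cover n b = y" using orb_cover_surj [OF n xy(2)] by blast
    show ?thesis using push [OF orb admissible_path_linepath [OF a(1) b(1)]] a b by blast
  qed
  have "induced_dist ?S ?\<rho> (g a) (g b) \<le> poincare_dist a b"
    if g: "M g" and ab: "a \<in> unit_disc" "b \<in> unit_disc" for g a b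
    unfolding poincare_dist_def
  proof (rule induced_dist_greatest [OF admissible_path_linepath [OF ab]])
    fix \<gamma> assume "admissible_path unit_disc (\<lambda>z. 2 / (1 - (norm z)\<^sup>2)) a b \<gamma>"
    from push [OF M(2) [OF g] this]
    show "induced_dist ?S ?\<rho> (g a) (g b) \<le> path_len (\<lambda>z. 2 / (1 - (norm z)\<^sup>2)) \<gamma>"
      using induced_dist_le_path_len [of ?S ?\<rho>, OF nonneg] by (meson order_trans)
  qed
  then have adm: "kob_admissible ?S M (induced_dist ?S ?\<rho>)"
    using pseudo_dist_on_induced_dist [of ?S ?\<rho>, OF nonneg ex] by (simp add: kob_admissible_def)
  have "d x y \<le> induced_dist ?S ?\<rho> x y" if d: "kob_admissible ?S M d" and xy: "x \<in> ?S" "y \<in> ?S" for d x y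
  proof -
    have d': "kob_admissible ?S (classical_orb_morphism n) d"
      using d M(1) by (simp add: kob_admissible_def)
    obtain \<gamma>0 where "admissible_path ?S ?\<rho> x y \<gamma>0" using ex [OF xy] by blast
    then show ?thesis
    proof (rule induced_dist_greatest)
      fix \<gamma> assume \<gamma>: "admissible_path ?S ?\<rho> x y \<gamma>"
      show "d x y \<le> path_len ?\<rho> \<gamma>"
      proof (cases "0 \<in> path_image \<gamma>")
        case True
        \<comment> \<open>A path through 0 can occur only for finite \<open>n\<close>.\<close>
        then have "0 \<in> ?S" using \<gamma> by (auto simp: admissible_path_def)
        then obtain m where m: "n = enat m" by (cases n) (auto simp: orb_domain_def)
        moreover have "0 < m" using n m by (simp add: one_enat_def)
        moreover have "?S = unit_disc" using m by (simp add: orb_domain_def)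
        ultimately show ?thesis using le_path_len_through_0 d' \<gamma> True by simp
      next
        case False
        then have "admissible_path (unit_disc - {0}) ?\<rho> x y \<gamma>"
          using \<gamma> orb_domain_subset [of n] by (auto simp: admissible_path_def)
        then show ?thesis by (rule le_path_len_avoiding_0 [OF n d'])
      qed
    qed
  qed
  with adm show ?thesis by (simp add: is_kobayashi_def)
qed

theorem theorem3p3:
  fixes n :: enat
  assumes "n \<ge> 1"
  shows "is_kobayashi (orb_domain n) (orb_morphism n)
            (induced_dist (orb_domain n) (omega_density n))
       \<and> is_kobayashi (orb_domain n) (classical_orb_morphism n)
            (induced_dist (orb_domain n) (omega_density n))"
  using assms classical_orb_morphism_imp_orb_morphism [OF assms]
  by (intro conjI is_kobayashi_induced_dist_omega) auto

end
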